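(* Consider the sparse matrix polynomial optimization problem $$f_{\min}=\min_{x\in\mathbb{R}^n}\ f(x)=f_1(x_{\Delta_1})+\cdots+f_m(x_{\Delta_m})\quad\text{s.t.}\quad G_i(x_{\Delta_i})\succeq 0,\ i=1,\ldots,m. \qquad (P)$$ Suppose $(P)$ has a minimizer $u$. Assume each $f_i$ is SOS-convex and each $G_i$ is SOS-concave. Then: (i) For all $k\ge k_0$, $f_k^{smo}=f_{\min}$. Moreover, if Slater's condition holds, then (for all $k\ge k_0$) $f_k^{spa}=f_{\min}$ and $$f-f_{\min}\in\mathrm{QM}[G]_{spa,2k}.$$ (ii) For every minimizer $y^*$ of the $k$th order sparse moment relaxation ($k\ge k_0$), the point $x^*=(y^*_{e_1},\ldots,y^*_{e_n})$ is a minimizer of $(P)$, where $e_j\in\mathbb{N}^n$ is the $j$th standard unit vector.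
   Context: Let $[m]=\{1,\ldots,m\}$. $\Delta_1,\ldots,\Delta_m$ are subsets of $[n]$ with $\Delta_1\cup\cdots\cup\Delta_m=[n]$. For $x\in\mathbb{R}^n$, $x_{\Delta_i}=(x_j)_{j\in\Delta_i}$. $\mathbb{R}[x_{\Delta_i}]$ is the ring of real polynomials in $x_{\Delta_i}$, with $\mathbb{R}[x_{\Delta_i}]_d$ the polynomials of degree at most $d$. Each $f_i\in\mathbb{R}[x_{\Delta_i}]$ and each $G_i$ is an $\ell_i\times\ell_i$ symmetric matrix with entries in $\mathbb{R}[x_{\Delta_i}]$; $\deg(G_i)$ is the maximum degree of its entries. $X\succeq0$ (resp. $X\succ0$) means positive semidefinite (resp. definite). The feasible set is $K=\{x\in\mathbb{R}^n:G_i(x_{\Delta_i})\succeq0,\ i\in[m]\}$; a minimizer of $(P)$ is $u\in K$ with $f(u)=f_{\min}$. Slater's condition: there exists $u\in\mathbb{R}^n$ with $G_i(u_{\Delta_i})\succ0$ for all $i\in[m]$. SOS-convexity: an $\ell\times\ell$ symmetric matrix polynomial $P(x)$ is SOS-convex if for every $\xi\in\mathbb{R}^\ell$ there is a matrix polynomial $Q(x)$ (possibly depending on $\xi$) with $\nabla^2(\xi^TP(x)\xi)=Q(x)^TQ(x)$, where $\nabla^2$ is the Hessian in the variables of $P$; scalar polynomials are the case $\ell=1$. $P$ is SOS-concave if $-P$ is SOS-convex. Here $f_i,G_i$ are regarded as polynomials in $x_{\Delta_i}$. SOS relaxation: $\Sigma[x_{\Delta_i}]_{2k}$ is the set of sums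 of squares in $\mathbb{R}[x_{\Delta_i}]$ of degree at most $2k$; $$\mathrm{QM}_{\Delta_i}[G_i]_{2k}=\Sigma[x_{\Delta_i}]_{2k}+\Big\{\sum_{j=1}^sP_j^TG_iP_j: s\in\mathbb{N},\ P_j\in\mathbb{R}[x_{\Delta_i}]^{\ell_i},\ 2\deg(P_j)+\deg(G_i)\le2k\Big\},$$ $\mathrm{QM}[G]_{spa,2k}=\sum_{i=1}^m\mathrm{QM}_{\Delta_i}[G_i]_{2k}$, and $f_k^{spa}=\sup\{\gamma:f-\gamma\in\mathrm{QM}[G]_{spa,2k}\}$. Moment relaxation: $\mathbb{N}^{\Delta_i}_d=\{\alpha\in\mathbb{N}^n:\alpha_j=0\ \forall j\notin\Delta_i,\ |\alpha|\le d\}$, $[x_{\Delta_i}]_d=(x^\alpha)_{\alpha\in\mathbb{N}_d^{\Delta_i}}$, $\mathbb{U}_k=\bigcup_{i}\mathbb{N}^{\Delta_i}_{2k}$. For $y\in\mathbb{R}^{\mathbb{U}_k}$, $y_{\Delta_i}=(y_\alpha)_{\alpha\in\mathbb{N}^{\Delta_i}_{2k}}$; $\mathscr{L}_{y_{\Delta_i}}$ is the linear functional on $\mathbb{R}[x_{\Delta_i}]_{2k}$ with $\mathscr{L}_{y_{\Delta_i}}(x^\alpha)=y_\alpha$, and $\langle p,y_{\Delta_i}\rangle=\mathscr{L}_{y_{\Delta_i}}(p)$. $M^{(k)}_{\Delta_i}[y_{\Delta_i}]=\mathscr{L}_{y_{\Delta_i}}([x_{\Delta_i}]_k[x_{\Delta_i}]_k^T)$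 (entrywise), and $L^{(k)}_{G_i}[y_{\Delta_i}]$ is the $\ell_i\times\ell_i$ block matrix with $(a,b)$ block $\mathscr{L}_{y_{\Delta_i}}((G_i)_{ab}[x_{\Delta_i}]_{k'}[x_{\Delta_i}]_{k'}^T)$, $k'=\lfloor k-\deg(G_i)/2\rfloor$. The $k$th order sparse moment relaxation, with optimal value $f_k^{smo}$, is $$\min_{y\in\mathbb{R}^{\mathbb{U}_k}}\ \langle f,y\rangle:=\sum_{i=1}^m\langle f_i,y_{\Delta_i}\rangle\quad\text{s.t.}\quad L^{(k)}_{G_i}[y_{\Delta_i}]\succeq0,\ M^{(k)}_{\Delta_i}[y_{\Delta_i}]\succeq0\ (i\in[m]),\ y_0=1.$$ Relaxation orders $k$ are positive integers, and $k_0=\max_{i\in[m]}\big(\lceil\deg(f_i)/2\rceil,\lceil\deg(G_i)/2\rceil\big)$. *)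

theory Defs
  imports "HOL-Analysis.Analysis" "HOL-Library.Poly_Mapping" "HOL-Library.Extended_Real"
begin

section \<open>Polynomials in the variables indexed by a finite type\<close>

text \<open>
  The coordinates \<open>1, \<dots>, n\<close> are the elements of a finite type \<open>'n\<close>, so that points are of type
  \<^typ>\<open>real ^ 'n\<close>. An exponent vector is an element of \<open>'n mono\<close>; the polynomial ring carries the
  convolution product that \<^theory>\<open>HOL-Library.Poly_Mapping\<close> provides. Index sets of the
  form \<open>[m]\<close> and \<open>[l]\<close> are sets \<open>{1..m}\<close> of natural numbers, and an \<open>l \<times> l\<close> matrix is
  a function of two indices that is only used on \<open>{1..l}\<close>.
\<close>

type_synonym 'n mono = "'n \<Rightarrow>\<^sub>0 nat"
type_synonym 'n mpoly = "('n \<Rightarrow>\<^sub>0 nat) \<Rightarrow>\<^sub>0 real"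

definition const_poly :: "real \<Rightarrow> 'n mpoly" where
  "const_poly c = Poly_Mapping.single 0 c"

definition mono_poly :: "'n mono \<Rightarrow> 'n mpoly" where
  "mono_poly \<alpha> = Poly_Mapping.single \<alpha> 1"

definition unit_mono :: "'n \<Rightarrow> 'n mono" where
  "unit_mono j = Poly_Mapping.single j 1"

definition mono_deg :: "'n::finite mono \<Rightarrow> nat" where
  "mono_deg \<alpha> = (\<Sum>j\<in>UNIV. Poly_Mapping.lookup \<alpha> j)"

text \<open>Total degree, with the convention that the zero polynomial has degree \<open>0\<close>.\<close>

definition poly_deg :: "'n::finite mpoly \<Rightarrow> nat" where
  "poly_deg p = (if p = 0 then 0 else Max (mono_deg ` Poly_Mapping.keys p))"

definition poly_eval :: "'n::finite mpoly \<Rightarrow> real ^ 'n \<Rightarrow> real" where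
  "poly_eval p x =
     (\<Sum>\<alpha>\<in>Poly_Mapping.keys p.
        Poly_Mapping.lookup p \<alpha> * (\<Prod>j\<in>UNIV. (x $ j) ^ Poly_Mapping.lookup \<alpha> j))"

text \<open>
  Formal partial derivative. The subtraction of exponents truncates, but it does so only where
  the exponent of \<open>j\<close> is \<open>0\<close>, and there the coefficient vanishes.
\<close>

definition partial :: "'n \<Rightarrow> 'n mpoly \<Rightarrow> 'n mpoly" where
  "partial j p =
     (\<Sum>\<alpha>\<in>Poly_Mapping.keys p.
        Poly_Mapping.single (\<alpha> - unit_mono j)
          (real (Poly_Mapping.lookup \<alpha> j) * Poly_Mapping.lookup p \<alpha>))"

text \<open>
  The subring \<open>\<real>[x\<^sub>D]\<close> of polynomials in the variables with index in \<open>D\<close>. Evaluating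
  such a polynomial at \<open>x\<close> only involves \<open>x\<^sub>D\<close>, which is why restrictions of points do not
  appear below.
\<close>

definition polys_in :: "'n set \<Rightarrow> 'n mpoly set" where
  "polys_in D = {p. \<forall>\<alpha>\<in>Poly_Mapping.keys p. Poly_Mapping.keys \<alpha> \<subseteq> D}"

definition vec_deg :: "nat \<Rightarrow> (nat \<Rightarrow> 'n::finite mpoly) \<Rightarrow> nat" where
  "vec_deg l P = Max ((\<lambda>a. poly_deg (P a)) ` {1..l})"

definition mat_deg :: "nat \<Rightarrow> (nat \<Rightarrow> nat \<Rightarrow> 'n::finite mpoly) \<Rightarrow> nat" where
  "mat_deg l G = Max ((\<lambda>(a, b). poly_deg (G a b)) ` ({1..l} \<times> {1..l}))"


section \<open>Definite matrices and SOS-convexity\<close>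

text \<open>Matrices with rows and columns indexed by an arbitrary finite set \<open>I\<close>.\<close>

definition psd_on :: "'i set \<Rightarrow> ('i \<Rightarrow> 'i \<Rightarrow> real) \<Rightarrow> bool" where
  "psd_on I X \<longleftrightarrow>
     (\<forall>a\<in>I. \<forall>b\<in>I. X a b = X b a) \<and>
     (\<forall>v. (\<Sum>a\<in>I. \<Sum>b\<in>I. v a * X a b * v b) \<ge> 0)"

definition pd_on :: "'i set \<Rightarrow> ('i \<Rightarrow> 'i \<Rightarrow> real) \<Rightarrow> bool" where
  "pd_on I X \<longleftrightarrow>
     (\<forall>a\<in>I. \<forall>b\<in>I. X a b = X b a) \<and>
     (\<forall>v. (\<exists>a\<in>I. v a \<noteq> 0) \<longrightarrow> (\<Sum>a\<in>I. \<Sum>b\<in>I. v a * X a b * v b) > 0)"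

definition quad_form :: "nat \<Rightarrow> (nat \<Rightarrow> nat \<Rightarrow> 'n mpoly) \<Rightarrow> (nat \<Rightarrow> real) \<Rightarrow> 'n mpoly" where
  "quad_form l P \<xi> = (\<Sum>a\<in>{1..l}. \<Sum>b\<in>{1..l}. const_poly (\<xi> a) * P a b * const_poly (\<xi> b))"

text \<open>
  SOS-convexity of an \<open>l \<times> l\<close> matrix polynomial in the variables \<open>x\<^sub>D\<close>: the factor \<open>Q\<close> of the
  Hessian has some number \<open>r\<close> of rows and its columns are indexed by \<open>D\<close>.
\<close>

definition sos_convex_mat :: "'n set \<Rightarrow> nat \<Rightarrow> (nat \<Rightarrow> nat \<Rightarrow> 'n mpoly) \<Rightarrow> bool" where
  "sos_convex_mat D l P \<longleftrightarrow>
     (\<forall>\<xi>. \<exists>(r::nat) (Q :: nat \<Rightarrow> 'n \<Rightarrow> 'n mpoly).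
        (\<forall>c\<in>{1..r}. \<forall>j\<in>D. Q c j \<in> polys_in D) \<and>
        (\<forall>i\<in>D. \<forall>j\<in>D.
           partial i (partial j (quad_form l P \<xi>)) = (\<Sum>c\<in>{1..r}. Q c i * Q c j)))"

definition sos_concave_mat :: "'n set \<Rightarrow> nat \<Rightarrow> (nat \<Rightarrow> nat \<Rightarrow> 'n mpoly) \<Rightarrow> bool" where
  "sos_concave_mat D l P \<longleftrightarrow> sos_convex_mat D l (\<lambda>a b. - P a b)"

definition sos_convex :: "'n set \<Rightarrow> 'n mpoly \<Rightarrow> bool" where
  "sos_convex D p \<longleftrightarrow> sos_convex_mat D 1 (\<lambda>_ _. p)"


section \<open>The sparse optimization problem\<close>

definition objective :: "nat \<Rightarrow> (nat \<Rightarrow> 'n mpoly) \<Rightarrow> 'n mpoly" where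
  "objective m f = (\<Sum>i\<in>{1..m}. f i)"

definition feasible_set ::
  "nat \<Rightarrow> (nat \<Rightarrow> nat) \<Rightarrow> (nat \<Rightarrow> nat \<Rightarrow> nat \<Rightarrow> 'n::finite mpoly) \<Rightarrow> (real ^ 'n) set" where
  "feasible_set m l G =
     {x. \<forall>i\<in>{1..m}. psd_on {1..l i} (\<lambda>a b. poly_eval (G i a b) x)}"

definition opt_value ::
  "nat \<Rightarrow> (nat \<Rightarrow> nat) \<Rightarrow> (nat \<Rightarrow> 'n::finite mpoly) \<Rightarrow>
   (nat \<Rightarrow> nat \<Rightarrow> nat \<Rightarrow> 'n mpoly) \<Rightarrow> ereal" where
  "opt_value m l f G = (INF x\<in>feasible_set m l G. ereal (poly_eval (objective m f) x))"

definition is_minimizer ::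
  "nat \<Rightarrow> (nat \<Rightarrow> nat) \<Rightarrow> (nat \<Rightarrow> 'n::finite mpoly) \<Rightarrow>
   (nat \<Rightarrow> nat \<Rightarrow> nat \<Rightarrow> 'n mpoly) \<Rightarrow> real ^ 'n \<Rightarrow> bool" where
  "is_minimizer m l f G u \<longleftrightarrow>
     u \<in> feasible_set m l G \<and> ereal (poly_eval (objective m f) u) = opt_value m l f G"

definition slater ::
  "nat \<Rightarrow> (nat \<Rightarrow> nat) \<Rightarrow> (nat \<Rightarrow> nat \<Rightarrow> nat \<Rightarrow> 'n::finite mpoly) \<Rightarrow> bool" where
  "slater m l G \<longleftrightarrow>
     (\<exists>u. \<forall>i\<in>{1..m}. pd_on {1..l i} (\<lambda>a b. poly_eval (G i a b) u))"

definition min_order ::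
  "nat \<Rightarrow> (nat \<Rightarrow> nat) \<Rightarrow> (nat \<Rightarrow> 'n::finite mpoly) \<Rightarrow>
   (nat \<Rightarrow> nat \<Rightarrow> nat \<Rightarrow> 'n mpoly) \<Rightarrow> nat" where
  "min_order m l f G =
     Max ((\<lambda>i. max (nat \<lceil>real (poly_deg (f i)) / 2\<rceil>)
                   (nat \<lceil>real (mat_deg (l i) (G i)) / 2\<rceil>)) ` {1..m})"


section \<open>Sparse SOS relaxation\<close>

definition sos_deg :: "'n::finite set \<Rightarrow> nat \<Rightarrow> 'n mpoly set" where
  "sos_deg D d =
     {p. poly_deg p \<le> d \<and>
         (\<exists>(s::nat) q. (\<forall>j\<in>{1..s}. q j \<in> polys_in D) \<and> p = (\<Sum>j\<in>{1..s}. (q j)\<^sup>2))}"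

definition qmod ::
  "'n::finite set \<Rightarrow> nat \<Rightarrow> (nat \<Rightarrow> nat \<Rightarrow> 'n mpoly) \<Rightarrow> nat \<Rightarrow> 'n mpoly set" where
  "qmod D l G k =
     {\<sigma> + (\<Sum>j\<in>{1..s}. \<Sum>a\<in>{1..l}. \<Sum>b\<in>{1..l}. P j a * G a b * P j b)
      | \<sigma> (s::nat) P.
        \<sigma> \<in> sos_deg D (2 * k) \<and>
        (\<forall>j\<in>{1..s}. (\<forall>a\<in>{1..l}. P j a \<in> polys_in D) \<and>
                    2 * vec_deg l (P j) + mat_deg l G \<le> 2 * k)}"

definition qmod_spa ::
  "nat \<Rightarrow> (nat \<Rightarrow> 'n::finite set) \<Rightarrow> (nat \<Rightarrow> nat) \<Rightarrow>
   (nat \<Rightarrow> nat \<Rightarrow> nat \<Rightarrow> 'n mpoly) \<Rightarrow> nat \<Rightarrow> 'n mpoly set" where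
  "qmod_spa m \<Delta> l G k =
     {\<Sum>i\<in>{1..m}. q i | q. \<forall>i\<in>{1..m}. q i \<in> qmod (\<Delta> i) (l i) (G i) k}"

definition spa_value ::
  "nat \<Rightarrow> (nat \<Rightarrow> 'n::finite set) \<Rightarrow> (nat \<Rightarrow> nat) \<Rightarrow> (nat \<Rightarrow> 'n mpoly) \<Rightarrow>
   (nat \<Rightarrow> nat \<Rightarrow> nat \<Rightarrow> 'n mpoly) \<Rightarrow> nat \<Rightarrow> ereal" where
  "spa_value m \<Delta> l f G k =
     (SUP \<gamma>\<in>{\<gamma>. objective m f - const_poly \<gamma> \<in> qmod_spa m \<Delta> l G k}. ereal \<gamma>)"


section \<open>Sparse moment relaxation\<close>

definition mono_set :: "'n::finite set \<Rightarrow> nat \<Rightarrow> 'n mono set" where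
  "mono_set D d = {\<alpha>. (\<forall>j. j \<notin> D \<longrightarrow> Poly_Mapping.lookup \<alpha> j = 0) \<and> mono_deg \<alpha> \<le> d}"

definition moment_index :: "nat \<Rightarrow> (nat \<Rightarrow> 'n::finite set) \<Rightarrow> nat \<Rightarrow> 'n mono set" where
  "moment_index m \<Delta> k = (\<Union>i\<in>{1..m}. mono_set (\<Delta> i) (2 * k))"

text \<open>
  The functional \<open>p \<mapsto> \<langle>p, y\<^sub>D\<rangle>\<close>. It is only applied to polynomials in \<open>x\<^sub>D\<close> of degree at most
  \<open>2 * k\<close>, so that it only reads the entries of the subvector \<open>y\<^sub>D\<close> of \<open>y\<close>.
\<close>

definition riesz :: "('n mono \<Rightarrow> real) \<Rightarrow> 'n mpoly \<Rightarrow> real" where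
  "riesz y p = (\<Sum>\<alpha>\<in>Poly_Mapping.keys p. Poly_Mapping.lookup p \<alpha> * y \<alpha>)"

definition moment_mat :: "('n mono \<Rightarrow> real) \<Rightarrow> 'n mono \<Rightarrow> 'n mono \<Rightarrow> real" where
  "moment_mat y \<alpha> \<beta> = riesz y (mono_poly \<alpha> * mono_poly \<beta>)"

text \<open>
  The entry of the localizing matrix in row \<open>\<alpha>\<close> and column \<open>\<beta>\<close> of block \<open>(a, b)\<close>; rows and
  columns of the whole block matrix are indexed by pairs.
\<close>

definition localizing_mat ::
  "(nat \<Rightarrow> nat \<Rightarrow> 'n mpoly) \<Rightarrow> ('n mono \<Rightarrow> real) \<Rightarrow>
   nat \<times> 'n mono \<Rightarrow> nat \<times> 'n mono \<Rightarrow> real" where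
  "localizing_mat G y = (\<lambda>(a, \<alpha>) (b, \<beta>). riesz y (G a b * (mono_poly \<alpha> * mono_poly \<beta>)))"

definition localizing_order ::
  "nat \<Rightarrow> (nat \<Rightarrow> nat \<Rightarrow> 'n::finite mpoly) \<Rightarrow> nat \<Rightarrow> nat" where
  "localizing_order l G k = nat \<lfloor>real k - real (mat_deg l G) / 2\<rfloor>"

text \<open>A vector \<open>y\<close> indexed by \<^term>\<open>moment_index m \<Delta> k\<close> is a function that is \<^term>\<open>undefined\<close> off that set.\<close>

definition moment_feasible ::
  "nat \<Rightarrow> (nat \<Rightarrow> 'n::finite set) \<Rightarrow> (nat \<Rightarrow> nat) \<Rightarrow>
   (nat \<Rightarrow> nat \<Rightarrow> nat \<Rightarrow> 'n mpoly) \<Rightarrow> nat \<Rightarrow> ('n mono \<Rightarrow> real) set" where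
  "moment_feasible m \<Delta> l G k =
     {y \<in> extensional (moment_index m \<Delta> k).
        (\<forall>i\<in>{1..m}.
           psd_on ({1..l i} \<times> mono_set (\<Delta> i) (localizing_order (l i) (G i) k))
                  (localizing_mat (G i) y) \<and>
           psd_on (mono_set (\<Delta> i) k) (moment_mat y)) \<and>
        y 0 = 1}"

definition moment_objective ::
  "nat \<Rightarrow> (nat \<Rightarrow> 'n mpoly) \<Rightarrow> ('n mono \<Rightarrow> real) \<Rightarrow> real" where
  "moment_objective m f y = (\<Sum>i\<in>{1..m}. riesz y (f i))"

definition smo_value ::
  "nat \<Rightarrow> (nat \<Rightarrow> 'n::finite set) \<Rightarrow> (nat \<Rightarrow> nat) \<Rightarrow> (nat \<Rightarrow> 'n mpoly) \<Rightarrow>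
   (nat \<Rightarrow> nat \<Rightarrow> nat \<Rightarrow> 'n mpoly) \<Rightarrow> nat \<Rightarrow> ereal" where
  "smo_value m \<Delta> l f G k =
     (INF y\<in>moment_feasible m \<Delta> l G k. ereal (moment_objective m f y))"

definition is_moment_minimizer ::
  "nat \<Rightarrow> (nat \<Rightarrow> 'n::finite set) \<Rightarrow> (nat \<Rightarrow> nat) \<Rightarrow> (nat \<Rightarrow> 'n mpoly) \<Rightarrow>
   (nat \<Rightarrow> nat \<Rightarrow> nat \<Rightarrow> 'n mpoly) \<Rightarrow> nat \<Rightarrow> ('n mono \<Rightarrow> real) \<Rightarrow> bool" where
  "is_moment_minimizer m \<Delta> l f G k y \<longleftrightarrow>
     y \<in> moment_feasible m \<Delta> l G k \<and>
     ereal (moment_objective m f y) = smo_value m \<Delta> l f G k"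

end

theory Submission
  imports Defs
begin

text \<open>
  Everything rests on one property of an SOS-convex polynomial \<open>p\<close> (\<open>sos_convex_remainder_is_sos\<close>): for
  every point \<open>a\<close>, the difference between \<open>p\<close> and its tangent at \<open>a\<close> is a sum of squares of polynomials
  in the same variables. Indeed Taylor's formula writes it as an integral of sums of squares, and an
  integral of squares of polynomials depending polynomially on a parameter is a finite sum of squares.

  For the moment relaxation this gives Jensen's inequality for pseudo-moments
  (\<open>jensen_pseudo_moments\<close>): with \<open>x\<close> the vector of first moments of \<open>y\<close>, \<open>p(x)\<close> is at most the
  pseudo-expectation of \<open>p\<close>. Applied to the objective and to the polynomials \<open>- \<xi>\<^sup>T G \<xi>\<close>, it shows that
  every feasible \<open>y\<close> yields a feasible point \<open>x\<close> whose objective value is no larger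
  (\<open>moment_feasible_lower_bound\<close>). Conversely the moments of a feasible point are feasible with the
  same value, so both problems have the same optimal value and minimizers are mapped to minimizers.

  For the sums of squares relaxation, Slater's condition provides semidefinite multipliers
  (\<open>matrix_multipliers\<close>), and factorizing them replaces each product \<open>\<langle>\<Lambda>, G\<rangle>\<close> by a sum of terms
  \<open>w\<^sup>T G w\<close>. The resulting Lagrangian is a sum of SOS-convex polynomials, one for each block \<open>\<Delta> i\<close>, and the
  minimizer \<open>u\<close> minimizes it without constraints. Subtracting from each summand its tangent at \<open>u\<close> leaves
  a sum of squares, and since the gradient of the Lagrangian vanishes at \<open>u\<close> the tangents together
  only contribute the minimal value. This is a certificate of membership in the sparse quadratic module.
\<close>

section \<open>Polynomials as functions\<close>

text \<open>
  The value of a polynomial at a point, the values of its partial derivatives there and its single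
  coefficients are all of the form \<open>riesz y p\<close>, each for its own \<open>y\<close>. Linearity and the product rule
  for \<open>riesz\<close> therefore serve pseudo-moments and point evaluation alike.
\<close>

definition mono_eval :: "'n::finite mono \<Rightarrow> real ^ 'n \<Rightarrow> real" where
  "mono_eval \<alpha> x = (\<Prod>j\<in>UNIV. (x $ j) ^ Poly_Mapping.lookup \<alpha> j)"

lemma poly_eval_riesz: "poly_eval p x = riesz (\<lambda>\<alpha>. mono_eval \<alpha> x) p"
  by (simp add: poly_eval_def riesz_def mono_eval_def)

lemma riesz_superset:
  assumes "finite S" "Poly_Mapping.keys p \<subseteq> S"
  shows "riesz y p = (\<Sum>\<alpha>\<in>S. Poly_Mapping.lookup p \<alpha> * y \<alpha>)"
  unfolding riesz_def
  by (rule sum.mono_neutral_left) (use assms in \<open>auto simp: in_keys_iff\<close>)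

lemma riesz_add: "riesz y (p + q) = riesz y p + riesz y q"
proof -
  let ?S = "Poly_Mapping.keys p \<union> Poly_Mapping.keys q"
  have "riesz y (p + q) = (\<Sum>\<alpha>\<in>?S. Poly_Mapping.lookup (p + q) \<alpha> * y \<alpha>)"
    using Poly_Mapping.keys_add[of p q] by (intro riesz_superset) auto
  also have "\<dots> = riesz y p + riesz y q"
    by (simp add: riesz_superset[of ?S] lookup_add algebra_simps sum.distrib)
  finally show ?thesis .
qed

lemma riesz_uminus: "riesz y (- p) = - riesz y p"
  by (simp add: riesz_def sum_negf)

lemma riesz_diff: "riesz y (p - q) = riesz y p - riesz y q"
  using riesz_add[of y p "- q"] by (simp add: riesz_uminus)

lemma riesz_zero: "riesz y 0 = 0"
  by (simp add: riesz_def)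

lemma riesz_sum: "riesz y (\<Sum>i\<in>I. p i) = (\<Sum>i\<in>I. riesz y (p i))"
  by (induction I rule: infinite_finite_induct) (auto simp: riesz_add riesz_zero)

lemma riesz_single: "riesz y (Poly_Mapping.single \<alpha> c) = c * y \<alpha>"
  by (simp add: riesz_def)

lemma sum_single_lookup:
  "(\<Sum>\<alpha>\<in>Poly_Mapping.keys p. Poly_Mapping.single \<alpha> (Poly_Mapping.lookup p \<alpha>)) = p"
proof (rule poly_mapping_eqI)
  fix \<beta>
  have "Poly_Mapping.lookup (\<Sum>\<alpha>\<in>Poly_Mapping.keys p. Poly_Mapping.single \<alpha> (Poly_Mapping.lookup p \<alpha>)) \<beta>
      = (\<Sum>\<alpha>\<in>Poly_Mapping.keys p. if \<alpha> = \<beta> then Poly_Mapping.lookup p \<alpha> else 0)"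
    by (simp add: lookup_sum lookup_single when_def)
  also have "\<dots> = Poly_Mapping.lookup p \<beta>"
    by (simp add: in_keys_iff)
  finally show "Poly_Mapping.lookup (\<Sum>\<alpha>\<in>Poly_Mapping.keys p. Poly_Mapping.single \<alpha> (Poly_Mapping.lookup p \<alpha>)) \<beta>
      = Poly_Mapping.lookup p \<beta>" .
qed

lemma riesz_mult:
  fixes p q :: "'n mpoly"
  shows "riesz y (p * q) =
    (\<Sum>\<alpha>\<in>Poly_Mapping.keys p. \<Sum>\<beta>\<in>Poly_Mapping.keys q.
       Poly_Mapping.lookup p \<alpha> * Poly_Mapping.lookup q \<beta> * y (\<alpha> + \<beta>))"
proof -
  have "p * q = (\<Sum>\<alpha>\<in>Poly_Mapping.keys p. Poly_Mapping.single \<alpha> (Poly_Mapping.lookup p \<alpha>)) *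
      (\<Sum>\<beta>\<in>Poly_Mapping.keys q. Poly_Mapping.single \<beta> (Poly_Mapping.lookup q \<beta>))"
    by (simp add: sum_single_lookup)
  also have "\<dots> = (\<Sum>\<alpha>\<in>Poly_Mapping.keys p. \<Sum>\<beta>\<in>Poly_Mapping.keys q.
       Poly_Mapping.single (\<alpha> + \<beta>) (Poly_Mapping.lookup p \<alpha> * Poly_Mapping.lookup q \<beta>))"
    by (simp add: sum_product mult_single)
  finally show ?thesis
    by (simp add: riesz_sum riesz_single)
qed

lemma mono_eval_add: "mono_eval (\<alpha> + \<beta>) x = mono_eval \<alpha> x * mono_eval \<beta> x"
  by (simp add: mono_eval_def lookup_add power_add prod.distrib)

lemma mono_eval_0 [simp]: "mono_eval 0 x = 1"
  by (simp add: mono_eval_def)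

lemma mono_eval_unit [simp]: "mono_eval (unit_mono j) x = x $ j"
proof -
  have "mono_eval (unit_mono j) x = (\<Prod>i\<in>UNIV. if i = j then x $ i else 1)"
    unfolding mono_eval_def unit_mono_def
    by (rule prod.cong) (auto simp: lookup_single when_def)
  also have "\<dots> = x $ j" by simp
  finally show ?thesis .
qed

abbreviation coord_poly :: "'n::finite \<Rightarrow> 'n mpoly" where
  "coord_poly j \<equiv> mono_poly (unit_mono j)"

lemma poly_eval_add [simp]: "poly_eval (p + q) x = poly_eval p x + poly_eval q x"
  by (simp add: poly_eval_riesz riesz_add)

lemma poly_eval_uminus [simp]: "poly_eval (- p) x = - poly_eval p x"
  by (simp add: poly_eval_riesz riesz_uminus)

lemma poly_eval_diff [simp]: "poly_eval (p - q) x = poly_eval p x - poly_eval q x"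
  by (simp add: poly_eval_riesz riesz_diff)

lemma poly_eval_zero [simp]: "poly_eval 0 x = 0"
  by (simp add: poly_eval_riesz riesz_zero)

lemma poly_eval_sum [simp]: "poly_eval (\<Sum>i\<in>I. p i) x = (\<Sum>i\<in>I. poly_eval (p i) x)"
  by (simp add: poly_eval_riesz riesz_sum)

lemma poly_eval_mult [simp]: "poly_eval (p * q) x = poly_eval p x * poly_eval q x"
  unfolding poly_eval_riesz riesz_mult mono_eval_add
  by (simp add: riesz_def sum_product mult_ac)

lemma poly_eval_mono [simp]: "poly_eval (mono_poly \<alpha>) x = mono_eval \<alpha> x"
  by (simp add: poly_eval_riesz mono_poly_def riesz_single)

lemma poly_eval_const [simp]: "poly_eval (const_poly c) x = c"
  by (simp add: poly_eval_riesz const_poly_def riesz_single)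

lemma poly_eval_power2 [simp]: "poly_eval (p\<^sup>2) x = (poly_eval p x)\<^sup>2"
  by (simp add: power2_eq_square)

text \<open>
  Splitting off one variable at a time: for fixed values of the others, a sum of monomials is a
  univariate polynomial in that variable, and each of its coefficients is a sum of the same kind.
  Injectivity on \<open>S\<close> says that exponents are told apart by the variables still in play.
\<close>

lemma monomial_sum_zero_imp_coeffs_zero:
  fixes c :: "('n \<Rightarrow> nat) \<Rightarrow> real"
  assumes "finite J" "finite S"
    and "\<And>\<alpha> \<beta>. \<alpha> \<in> S \<Longrightarrow> \<beta> \<in> S \<Longrightarrow> (\<And>j. j \<in> J \<Longrightarrow> \<alpha> j = \<beta> j) \<Longrightarrow> \<alpha> = \<beta>"
    and "\<And>x :: 'n \<Rightarrow> real. (\<Sum>\<alpha>\<in>S. c \<alpha> * (\<Prod>j\<in>J. x j ^ \<alpha> j)) = 0"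
    and "\<gamma> \<in> S"
  shows "c \<gamma> = 0"
  using assms
proof (induction J arbitrary: S rule: finite_induct)
  case empty
  then have "S = {\<gamma>}" by blast
  with empty.prems(3) show ?case by simp
next
  case (insert i J)
  let ?N = "Max ((\<lambda>\<alpha>. \<alpha> i) ` S)"
  let ?S = "\<lambda>d. {\<alpha> \<in> S. \<alpha> i = d}"
  have N: "\<alpha> i \<le> ?N" if "\<alpha> \<in> S" for \<alpha>
    using that insert.prems(1) by simp
  have coeff: "(\<Sum>\<alpha>\<in>?S d. c \<alpha> * (\<Prod>j\<in>J. x j ^ \<alpha> j)) = 0" if "d \<le> ?N" for d x
  proof -
    have "(\<Sum>d\<le>?N. (\<Sum>\<alpha>\<in>?S d. c \<alpha> * (\<Prod>j\<in>J. x j ^ \<alpha> j)) * t ^ d) = 0" for t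
    proof -
      let ?y = "x(i := t)"
      have "0 = (\<Sum>\<alpha>\<in>S. c \<alpha> * (\<Prod>j\<in>insert i J. ?y j ^ \<alpha> j))"
        using insert.prems(3) by simp
      also have "\<dots> = (\<Sum>\<alpha>\<in>S. c \<alpha> * (\<Prod>j\<in>J. x j ^ \<alpha> j) * t ^ \<alpha> i)"
      proof (rule sum.cong, simp)
        fix \<alpha>
        have "(\<Prod>j\<in>J. ?y j ^ \<alpha> j) = (\<Prod>j\<in>J. x j ^ \<alpha> j)"
          using insert.hyps(2) by (intro prod.cong) auto
        then show "c \<alpha> * (\<Prod>j\<in>insert i J. ?y j ^ \<alpha> j) = c \<alpha> * (\<Prod>j\<in>J. x j ^ \<alpha> j) * t ^ \<alpha> i"
          using insert.hyps by simp
      qed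
      also have "\<dots> = (\<Sum>d\<le>?N. \<Sum>\<alpha>\<in>?S d. c \<alpha> * (\<Prod>j\<in>J. x j ^ \<alpha> j) * t ^ \<alpha> i)"
        using insert.prems(1) N by (intro sum.group[symmetric]) auto
      finally show ?thesis
        by (simp add: sum_distrib_right)
    qed
    then show ?thesis
      using polyfun_eq_0[of "\<lambda>d. \<Sum>\<alpha>\<in>?S d. c \<alpha> * (\<Prod>j\<in>J. x j ^ \<alpha> j)" ?N] that
      by auto
  qed
  show ?case
  proof (rule insert.IH[of "?S (\<gamma> i)"])
    show "\<alpha> = \<beta>" if "\<alpha> \<in> ?S (\<gamma> i)" "\<beta> \<in> ?S (\<gamma> i)" "\<And>j. j \<in> J \<Longrightarrow> \<alpha> j = \<beta> j" for \<alpha> \<beta>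
      using that by (intro insert.prems(2)) auto
  qed (use insert.prems coeff N in auto)
qed

text \<open>
  Membership in the quadratic module is an identity of formal polynomials, while the arguments below
  (Taylor's formula, vanishing gradients) yield identities of functions; this passes from one to the
  other.
\<close>

lemma poly_eval_eq_imp_eq:
  fixes p q :: "'n::finite mpoly"
  assumes "\<And>x. poly_eval p x = poly_eval q x"
  shows "p = q"
proof -
  let ?r = "p - q"
  let ?S = "Poly_Mapping.lookup ` Poly_Mapping.keys ?r"
  have inj: "inj_on Poly_Mapping.lookup (Poly_Mapping.keys ?r)"
    by (simp add: inj_on_def)
  have coeff: "Poly_Mapping.lookup ?r (Abs_poly_mapping \<gamma>) = 0" if \<gamma>: "\<gamma> \<in> ?S" for \<gamma>
  proof (rule monomial_sum_zero_imp_coeffs_zero[of UNIV ?S _ \<gamma>])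
    fix x :: "'n \<Rightarrow> real"
    have "(\<Sum>\<alpha>\<in>?S. Poly_Mapping.lookup ?r (Abs_poly_mapping \<alpha>) * (\<Prod>j\<in>UNIV. x j ^ \<alpha> j))
        = poly_eval ?r (\<chi> j. x j)"
      by (simp add: sum.reindex[OF inj] poly_eval_def lookup_inverse)
    also have "\<dots> = 0" using assms by simp
    finally show "(\<Sum>\<alpha>\<in>?S. Poly_Mapping.lookup ?r (Abs_poly_mapping \<alpha>) * (\<Prod>j\<in>UNIV. x j ^ \<alpha> j)) = 0" .
  qed (use \<gamma> in auto)
  have "Poly_Mapping.keys ?r = {}"
  proof (rule ccontr)
    assume "Poly_Mapping.keys ?r \<noteq> {}"
    then obtain \<alpha> where \<alpha>: "\<alpha> \<in> Poly_Mapping.keys ?r" by blast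
    then show False
      using coeff[of "Poly_Mapping.lookup \<alpha>"] by (simp add: lookup_inverse in_keys_iff)
  qed
  then show ?thesis by simp
qed

subsection \<open>Derivatives\<close>

lemma poly_eval_partial:
  "poly_eval (partial j p) x =
    riesz (\<lambda>\<alpha>. real (Poly_Mapping.lookup \<alpha> j) * mono_eval (\<alpha> - unit_mono j) x) p"
  unfolding partial_def poly_eval_sum riesz_def
  by (intro sum.cong) (simp_all add: poly_eval_riesz riesz_single mult_ac)

lemma mono_eval_has_derivative_on_line:
  fixes a h :: "real ^ 'n::finite"
  shows "((\<lambda>t. mono_eval \<alpha> (a + t *\<^sub>R h)) has_real_derivative
      (\<Sum>j\<in>UNIV. h $ j * (real (Poly_Mapping.lookup \<alpha> j) *
          mono_eval (\<alpha> - unit_mono j) (a + t *\<^sub>R h)))) (at t)"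
proof -
  let ?x = "a + t *\<^sub>R h"
  have "((\<lambda>t. mono_eval \<alpha> (a + t *\<^sub>R h)) has_real_derivative
      (\<Sum>j\<in>UNIV. (real (Poly_Mapping.lookup \<alpha> j) * ?x $ j ^ (Poly_Mapping.lookup \<alpha> j - 1) * h $ j) *
         (\<Prod>i\<in>UNIV - {j}. ?x $ i ^ Poly_Mapping.lookup \<alpha> i))) (at t)"
    unfolding mono_eval_def
    by (rule has_field_derivative_prod)
       (auto intro!: derivative_eq_intros simp: algebra_simps)
  also have "(\<Sum>j\<in>UNIV. (real (Poly_Mapping.lookup \<alpha> j) * ?x $ j ^ (Poly_Mapping.lookup \<alpha> j - 1) * h $ j) *
         (\<Prod>i\<in>UNIV - {j}. ?x $ i ^ Poly_Mapping.lookup \<alpha> i)) =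
      (\<Sum>j\<in>UNIV. h $ j * (real (Poly_Mapping.lookup \<alpha> j) * mono_eval (\<alpha> - unit_mono j) ?x))"
  proof (rule sum.cong, simp)
    fix j
    have "mono_eval (\<alpha> - unit_mono j) ?x = ?x $ j ^ (Poly_Mapping.lookup \<alpha> j - 1) *
        (\<Prod>i\<in>UNIV - {j}. ?x $ i ^ Poly_Mapping.lookup (\<alpha> - unit_mono j) i)"
      unfolding mono_eval_def
      by (subst prod.remove[of UNIV j]) (auto simp: lookup_minus unit_mono_def)
    also have "(\<Prod>i\<in>UNIV - {j}. ?x $ i ^ Poly_Mapping.lookup (\<alpha> - unit_mono j) i) =
        (\<Prod>i\<in>UNIV - {j}. ?x $ i ^ Poly_Mapping.lookup \<alpha> i)"
      by (rule prod.cong) (auto simp: lookup_minus unit_mono_def lookup_single when_def)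
    finally show "(real (Poly_Mapping.lookup \<alpha> j) * ?x $ j ^ (Poly_Mapping.lookup \<alpha> j - 1) * h $ j) *
         (\<Prod>i\<in>UNIV - {j}. ?x $ i ^ Poly_Mapping.lookup \<alpha> i) =
      h $ j * (real (Poly_Mapping.lookup \<alpha> j) * mono_eval (\<alpha> - unit_mono j) ?x)"
      by (simp add: mult_ac)
  qed
  finally show ?thesis .
qed

lemma poly_eval_has_derivative_on_line:
  fixes a h :: "real ^ 'n::finite"
  shows "((\<lambda>t. poly_eval p (a + t *\<^sub>R h)) has_real_derivative
      (\<Sum>j\<in>UNIV. h $ j * poly_eval (partial j p) (a + t *\<^sub>R h))) (at t)"
proof -
  have "((\<lambda>t. \<Sum>\<alpha>\<in>Poly_Mapping.keys p. Poly_Mapping.lookup p \<alpha> * mono_eval \<alpha> (a + t *\<^sub>R h))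
     has_real_derivative (\<Sum>\<alpha>\<in>Poly_Mapping.keys p. Poly_Mapping.lookup p \<alpha> *
       (\<Sum>j\<in>UNIV. h $ j * (real (Poly_Mapping.lookup \<alpha> j) *
          mono_eval (\<alpha> - unit_mono j) (a + t *\<^sub>R h))))) (at t)"
    by (intro DERIV_sum DERIV_cmult mono_eval_has_derivative_on_line)
  also have "(\<Sum>\<alpha>\<in>Poly_Mapping.keys p. Poly_Mapping.lookup p \<alpha> *
       (\<Sum>j\<in>UNIV. h $ j * (real (Poly_Mapping.lookup \<alpha> j) *
          mono_eval (\<alpha> - unit_mono j) (a + t *\<^sub>R h)))) =
      (\<Sum>j\<in>UNIV. h $ j * poly_eval (partial j p) (a + t *\<^sub>R h))"
    unfolding poly_eval_partial riesz_def sum_distrib_left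
    by (subst sum.swap) (simp add: mult_ac)
  finally show ?thesis
    by (simp add: poly_eval_riesz riesz_def)
qed

subsection \<open>Variables and degree\<close>

lemma polys_in_add: "p \<in> polys_in D \<Longrightarrow> q \<in> polys_in D \<Longrightarrow> p + q \<in> polys_in D"
  using Poly_Mapping.keys_add[of p q] by (fastforce simp: polys_in_def)

lemma polys_in_uminus: "p \<in> polys_in D \<Longrightarrow> - p \<in> polys_in D"
  by (simp add: polys_in_def)

lemma polys_in_diff: "p \<in> polys_in D \<Longrightarrow> q \<in> polys_in D \<Longrightarrow> p - q \<in> polys_in D"
  using polys_in_add[of p D "- q"] by (simp add: polys_in_uminus)

lemma polys_in_zero: "0 \<in> polys_in D"
  by (simp add: polys_in_def)

lemma polys_in_sum: "(\<And>i. i \<in> I \<Longrightarrow> p i \<in> polys_in D) \<Longrightarrow> (\<Sum>i\<in>I. p i) \<in> polys_in D"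
  by (induction I rule: infinite_finite_induct) (auto simp: polys_in_zero polys_in_add)

lemma polys_in_mult:
  assumes "p \<in> polys_in D" "q \<in> polys_in D"
  shows "p * q \<in> polys_in D"
  unfolding polys_in_def
proof (intro CollectI ballI)
  fix \<gamma> assume "\<gamma> \<in> Poly_Mapping.keys (p * q)"
  then obtain \<alpha> \<beta> where "\<alpha> \<in> Poly_Mapping.keys p" "\<beta> \<in> Poly_Mapping.keys q" "\<gamma> = \<alpha> + \<beta>"
    using keys_mult[of p q] by blast
  then show "Poly_Mapping.keys \<gamma> \<subseteq> D"
    using assms Poly_Mapping.keys_add[of \<alpha> \<beta>] by (fastforce simp: polys_in_def)
qed

lemma polys_in_const: "const_poly c \<in> polys_in D"
  by (simp add: polys_in_def const_poly_def)

lemma polys_in_mono: "Poly_Mapping.keys \<alpha> \<subseteq> D \<Longrightarrow> mono_poly \<alpha> \<in> polys_in D"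
  by (simp add: polys_in_def mono_poly_def)

lemma polys_in_coord: "j \<in> D \<Longrightarrow> coord_poly j \<in> polys_in D"
  by (simp add: polys_in_mono unit_mono_def)

lemma polys_in_lookup_zero:
  assumes "p \<in> polys_in D" "\<alpha> \<in> Poly_Mapping.keys p" "j \<notin> D"
  shows "Poly_Mapping.lookup \<alpha> j = 0"
proof -
  have "Poly_Mapping.keys \<alpha> \<subseteq> D"
    using assms(1,2) by (simp add: polys_in_def)
  then show ?thesis
    using assms(3) by (meson in_keys_iff subsetD)
qed

lemma partial_eq_zero:
  assumes "p \<in> polys_in D" "j \<notin> D"
  shows "partial j p = 0"
  unfolding partial_def
proof (rule sum.neutral, rule ballI)
  fix \<alpha> assume "\<alpha> \<in> Poly_Mapping.keys p"
  then have "Poly_Mapping.lookup \<alpha> j = 0"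
    using assms by (intro polys_in_lookup_zero)
  then show "Poly_Mapping.single (\<alpha> - unit_mono j)
      (real (Poly_Mapping.lookup \<alpha> j) * Poly_Mapping.lookup p \<alpha>) = 0"
    by simp
qed

lemma polys_in_partial:
  assumes "p \<in> polys_in D"
  shows "partial j p \<in> polys_in D"
  unfolding partial_def
proof (rule polys_in_sum)
  fix \<alpha> assume "\<alpha> \<in> Poly_Mapping.keys p"
  then have "Poly_Mapping.keys \<alpha> \<subseteq> D"
    using assms by (simp add: polys_in_def)
  moreover have "Poly_Mapping.keys (\<alpha> - unit_mono j) \<subseteq> Poly_Mapping.keys \<alpha>"
    by (auto simp: in_keys_iff lookup_minus)
  ultimately have "Poly_Mapping.keys (\<alpha> - unit_mono j) \<subseteq> D"
    by blast
  then show "Poly_Mapping.single (\<alpha> - unit_mono j)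
      (real (Poly_Mapping.lookup \<alpha> j) * Poly_Mapping.lookup p \<alpha>) \<in> polys_in D"
    by (auto simp: polys_in_def)
qed

lemma poly_deg_le_iff:
  "poly_deg p \<le> d \<longleftrightarrow> (\<forall>\<alpha>\<in>Poly_Mapping.keys p. mono_deg \<alpha> \<le> d)"
proof (cases "p = 0")
  case False
  then have "Poly_Mapping.keys p \<noteq> {}" by simp
  then show ?thesis using False by (simp add: poly_deg_def)
qed (simp add: poly_deg_def)

lemma mono_deg_add: "mono_deg (\<alpha> + \<beta>) = mono_deg \<alpha> + mono_deg \<beta>"
  by (simp add: mono_deg_def lookup_add sum.distrib)

lemma poly_deg_add: "poly_deg p \<le> d \<Longrightarrow> poly_deg q \<le> d \<Longrightarrow> poly_deg (p + q) \<le> d"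
  using Poly_Mapping.keys_add[of p q] by (auto simp: poly_deg_le_iff)

lemma poly_deg_uminus [simp]: "poly_deg (- p) = poly_deg p"
  by (simp add: poly_deg_def)

lemma poly_deg_diff: "poly_deg p \<le> d \<Longrightarrow> poly_deg q \<le> d \<Longrightarrow> poly_deg (p - q) \<le> d"
  using poly_deg_add[of p d "- q"] by simp

lemma poly_deg_sum: "(\<And>i. i \<in> I \<Longrightarrow> poly_deg (p i) \<le> d) \<Longrightarrow> poly_deg (\<Sum>i\<in>I. p i) \<le> d"
  by (induction I rule: infinite_finite_induct) (auto simp: poly_deg_add poly_deg_def[of 0])

lemma poly_deg_mult:
  assumes "poly_deg p \<le> d" "poly_deg q \<le> e"
  shows "poly_deg (p * q) \<le> d + e"
  unfolding poly_deg_le_iff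
proof
  fix \<gamma> assume "\<gamma> \<in> Poly_Mapping.keys (p * q)"
  then obtain \<alpha> \<beta> where "\<alpha> \<in> Poly_Mapping.keys p" "\<beta> \<in> Poly_Mapping.keys q" "\<gamma> = \<alpha> + \<beta>"
    using keys_mult[of p q] by blast
  then show "mono_deg \<gamma> \<le> d + e"
    using assms by (auto simp: poly_deg_le_iff mono_deg_add intro!: add_mono)
qed

lemma poly_deg_const [simp]: "poly_deg (const_poly c) = 0"
proof -
  have "poly_deg (const_poly c) \<le> 0"
    unfolding poly_deg_le_iff by (simp add: const_poly_def mono_deg_def)
  then show ?thesis by simp
qed

lemma mono_deg_unit [simp]: "mono_deg (unit_mono j) = 1"
  by (simp add: mono_deg_def unit_mono_def lookup_single when_def)

lemma poly_deg_mono: "poly_deg (mono_poly \<alpha>) \<le> mono_deg \<alpha>"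
  by (simp add: poly_deg_le_iff mono_poly_def)

section \<open>Positive semidefinite matrices\<close>

lemma quadratic_form_insert:
  fixes X :: "'i \<Rightarrow> 'i \<Rightarrow> real"
  assumes "finite I" "j \<notin> I" "\<And>a. a \<in> I \<Longrightarrow> X a j = X j a"
  shows "(\<Sum>a\<in>insert j I. \<Sum>b\<in>insert j I. v a * X a b * v b) =
    X j j * (v j)\<^sup>2 + 2 * v j * (\<Sum>a\<in>I. X j a * v a) + (\<Sum>a\<in>I. \<Sum>b\<in>I. v a * X a b * v b)"
proof -
  have "(\<Sum>a\<in>I. v a * X a j * v j) = v j * (\<Sum>a\<in>I. X j a * v a)"
    unfolding sum_distrib_left using assms(3) by (intro sum.cong) auto
  moreover have "(\<Sum>b\<in>I. v j * X j b * v b) = v j * (\<Sum>a\<in>I. X j a * v a)"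
    unfolding sum_distrib_left by (intro sum.cong) auto
  ultimately show ?thesis
    using assms(1,2) by (simp add: sum.distrib power2_eq_square)
qed

text \<open>
  Induction on the size: removing the index \<open>j\<close> leaves the Schur complement \<open>Y\<close>, which is again
  semidefinite because its form is that of \<open>X\<close> minimized over the coordinate \<open>j\<close>. If the pivot
  \<open>X j j\<close> vanishes, then so does its whole row, and division by zero gives the right result.
\<close>

lemma psd_factorization:
  fixes X :: "'i \<Rightarrow> 'i \<Rightarrow> real"
  assumes "finite I" "psd_on I X"
  shows "\<exists>(r::nat) w. \<forall>a\<in>I. \<forall>b\<in>I. X a b = (\<Sum>c\<in>{1..r}. w c a * w c b)"
  using assms
proof (induction I arbitrary: X rule: finite_induct)
  case empty
  show ?case by simp
next
  case (insert j I)
  note sym = insert.prems[unfolded psd_on_def, THEN conjunct1, rule_format]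
  have form: "0 \<le> X j j * (v j)\<^sup>2 + 2 * v j * (\<Sum>a\<in>I. X j a * v a)
      + (\<Sum>a\<in>I. \<Sum>b\<in>I. v a * X a b * v b)" for v
  proof -
    have "(\<Sum>a\<in>insert j I. \<Sum>b\<in>insert j I. v a * X a b * v b) \<ge> 0"
      using insert.prems unfolding psd_on_def by blast
    moreover have "X a j = X j a" if "a \<in> I" for a using that by (simp add: sym)
    ultimately show ?thesis
      using quadratic_form_insert[of I j X v] insert.hyps by simp
  qed
  define Y where "Y a b = X a b - X j a * X j b / X j j" for a b
  have diag: "X j j \<ge> 0"
  proof -
    define v :: "'i \<Rightarrow> real" where "v a = (if a = j then 1 else 0)" for a
    have "v a = 0" if "a \<in> I" for a using that insert.hyps by (auto simp: v_def)
    then have "(\<Sum>a\<in>I. X j a * v a) = 0" "(\<Sum>a\<in>I. \<Sum>b\<in>I. v a * X a b * v b) = 0"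
      by (simp_all add: sum.neutral)
    then show ?thesis using form[of v] by (simp add: v_def)
  qed
  have zero: "X j a = 0" if "X j j = 0" "a \<in> I" for a
  proof (rule ccontr)
    assume nz: "X j a \<noteq> 0"
    \<comment> \<open>Chosen to give the form the value \<open>- 1\<close> at \<open>s\<close> times the \<open>j\<close>-th plus the \<open>a\<close>-th unit vector.\<close>
    define s where "s = - (X a a + 1) / (2 * X j a)"
    define v where "v b = (if b = j then s else if b = a then 1 else 0)" for b
    have v: "v b = (if b = a then 1 else 0)" if "b \<in> I" for b
      using that insert.hyps unfolding v_def by auto
    have "(\<Sum>b\<in>I. X j b * v b) = (\<Sum>b\<in>I. if b = a then X j b else 0)"
      by (intro sum.cong) (simp_all add: v)
    then have "(\<Sum>b\<in>I. X j b * v b) = X j a"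
      using that insert.hyps by simp
    moreover have "(\<Sum>b\<in>I. \<Sum>c\<in>I. v b * X b c * v c) =
        (\<Sum>b\<in>I. if b = a then \<Sum>c\<in>I. if c = a then X b c else 0 else 0)"
    proof (rule sum.cong, simp)
      fix b assume "b \<in> I"
      show "(\<Sum>c\<in>I. v b * X b c * v c) = (if b = a then \<Sum>c\<in>I. if c = a then X b c else 0 else 0)"
      proof (cases "b = a")
        case True
        then show ?thesis using \<open>b \<in> I\<close> v by (auto intro!: sum.cong)
      qed (simp add: v[OF \<open>b \<in> I\<close>])
    qed
    then have "(\<Sum>b\<in>I. \<Sum>c\<in>I. v b * X b c * v c) = X a a"
      using that insert.hyps by simp
    moreover have "v j = s" by (simp add: v_def)
    ultimately have "0 \<le> 2 * s * X j a + X a a"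
      using form[of v] that(1) by simp
    moreover have "2 * s * X j a = - (X a a + 1)" using nz by (simp add: s_def)
    ultimately show False by linarith
  qed
  have Y_form: "(\<Sum>a\<in>I. \<Sum>b\<in>I. v a * Y a b * v b) =
      (\<Sum>a\<in>I. \<Sum>b\<in>I. v a * X a b * v b) - (\<Sum>a\<in>I. X j a * v a)\<^sup>2 / X j j" for v
    by (simp add: Y_def algebra_simps sum_subtractf power2_eq_square sum_product
        sum_divide_distrib)
  have "psd_on I Y"
    unfolding psd_on_def
  proof (intro conjI ballI allI)
    fix a b assume "a \<in> I" "b \<in> I"
    then show "Y a b = Y b a" using sym by (simp add: Y_def)
  next
    fix v
    \<comment> \<open>The completion \<open>v j\<close> that minimizes the form over the coordinate \<open>j\<close>.\<close>
    define t where "t = (\<Sum>a\<in>I. X j a * v a)"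
    define v' where "v' = v(j := - t / X j j)"
    have v': "v' a = v a" if "a \<in> I" for a
      using that insert.hyps by (auto simp: v'_def)
    have "0 \<le> X j j * (- t / X j j)\<^sup>2 + 2 * (- t / X j j) * t
        + (\<Sum>a\<in>I. \<Sum>b\<in>I. v a * X a b * v b)"
      using form[of v'] v' by (simp add: t_def v'_def cong: sum.cong)
    also have "\<dots> = (\<Sum>a\<in>I. \<Sum>b\<in>I. v a * Y a b * v b)"
      unfolding Y_form t_def[symmetric] by (cases "X j j = 0") (simp_all add: power2_eq_square)
    finally show "0 \<le> (\<Sum>a\<in>I. \<Sum>b\<in>I. v a * Y a b * v b)" .
  qed
  then obtain r :: nat and w where w: "\<And>a b. a \<in> I \<Longrightarrow> b \<in> I \<Longrightarrow> Y a b = (\<Sum>c\<in>{1..r}. w c a * w c b)"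
    using insert.IH[OF \<open>psd_on I Y\<close>] by blast
  define w' where "w' c a = (if c = Suc r then X j a / sqrt (X j j) else if a = j then 0 else w c a)" for c a
  have split: "(\<Sum>c\<in>{1..Suc r}. w' c a * w' c b) =
      (\<Sum>c\<in>{1..r}. w' c a * w' c b) + X j a * X j b / X j j" for a b
    using diag by (simp add: w'_def)
  have "X a b = (\<Sum>c\<in>{1..Suc r}. w' c a * w' c b)" if "a \<in> insert j I" "b \<in> insert j I" for a b
  proof (cases "a = j \<or> b = j")
    case True
    then have "(\<Sum>c\<in>{1..r}. w' c a * w' c b) = 0"
      by (intro sum.neutral) (auto simp: w'_def)
    moreover have "X a b = X j a * X j b / X j j"
    proof (cases "X j j = 0")
      case True
      then have "X j c = 0" if "c \<in> insert j I" for c using zero that by blast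
      then show ?thesis using \<open>a = j \<or> b = j\<close> that sym[of a b] by auto
    next
      case False
      then show ?thesis using \<open>a = j \<or> b = j\<close> sym[OF that] by auto
    qed
    ultimately show ?thesis using split by simp
  next
    case False
    then have "(\<Sum>c\<in>{1..r}. w' c a * w' c b) = (\<Sum>c\<in>{1..r}. w c a * w c b)"
      by (intro sum.cong) (auto simp: w'_def)
    also have "\<dots> = Y a b" using w that False by simp
    finally show ?thesis using split[of a b] by (simp add: Y_def)
  qed
  then show ?case by blast
qed

text \<open>
  The form attains its minimum on the unit sphere. Vectors indexed by \<open>I\<close> are represented by functions
  that vanish off \<open>I\<close>, which makes the sphere compact in the product topology of \<open>'i \<Rightarrow> real\<close>.
\<close>

lemma pd_coercive:
  fixes X :: "'i \<Rightarrow> 'i \<Rightarrow> real"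
  assumes I: "finite I" and pd: "pd_on I X"
  shows "\<exists>\<delta>>0. \<forall>v. \<delta> * (\<Sum>a\<in>I. (v a)\<^sup>2) \<le> (\<Sum>a\<in>I. \<Sum>b\<in>I. v a * X a b * v b)"
proof -
  define F where "F v = (\<Sum>a\<in>I. \<Sum>b\<in>I. v a * X a b * v b)" for v :: "'i \<Rightarrow> real"
  define N where "N v = (\<Sum>a\<in>I. (v a)\<^sup>2)" for v :: "'i \<Rightarrow> real"
  define K where "K = PiE UNIV (\<lambda>a. if a \<in> I then {-1..1} else {0}) \<inter> {v. N v = 1}"
  have cont: "continuous_on UNIV (\<lambda>v :: 'i \<Rightarrow> real. v a)" for a
    by (rule continuous_on_product_coordinates)
  have contF: "continuous_on UNIV F" and contN: "continuous_on UNIV N"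
    unfolding F_def N_def by (intro continuous_intros cont)+
  have "closed {v. N v = 1}"
    using contN by (intro closed_Collect_eq) auto
  moreover have "compact (PiE (UNIV :: 'i set) (\<lambda>a. if a \<in> I then {-1..1::real} else {0}))"
    using compactin_PiE[of "\<lambda>_. euclidean" "UNIV :: 'i set" "\<lambda>a. if a \<in> I then {-1..1::real} else {0}"]
    by (auto simp: euclidean_product_topology)
  ultimately have K: "compact K"
    unfolding K_def by (rule compact_Int_closed[rotated])
  have pos: "F v > 0" if "N v \<noteq> 0" for v
  proof -
    have "\<exists>a\<in>I. v a \<noteq> 0"
    proof (rule ccontr)
      assume "\<not> (\<exists>a\<in>I. v a \<noteq> 0)"
      then have "N v = 0" by (simp add: N_def)
      with that show False by simp
    qed
    then show ?thesis using pd unfolding pd_on_def F_def by blast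
  qed
  have "\<exists>\<delta>>0. \<forall>v\<in>K. \<delta> \<le> F v"
  proof (cases "K = {}")
    case True then show ?thesis by (intro exI[of _ 1]) simp
  next
    case False
    then obtain v0 where v0: "v0 \<in> K" "\<And>v. v \<in> K \<Longrightarrow> F v0 \<le> F v"
      using continuous_attains_inf[OF K _ continuous_on_subset[OF contF]] by blast
    then have "F v0 > 0" by (intro pos) (simp add: K_def)
    with v0 show ?thesis by blast
  qed
  then obtain \<delta> where \<delta>: "\<delta> > 0" "\<And>v. v \<in> K \<Longrightarrow> \<delta> \<le> F v" by blast
  have "\<delta> * N v \<le> F v" for v
  proof (cases "N v = 0")
    case True
    then have "\<forall>a\<in>I. v a = 0" using I by (simp add: N_def sum_nonneg_eq_0_iff)
    then show ?thesis using True by (simp add: F_def)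
  next
    case False
    have "N v \<ge> 0" by (simp add: N_def sum_nonneg)
    with False have Npos: "N v > 0" by simp
    define s where "s = sqrt (N v)"
    have s: "s > 0" "s\<^sup>2 = N v" using Npos by (simp_all add: s_def)
    define w where "w a = (if a \<in> I then v a / s else 0)" for a
    have Fw: "F w = F v / s\<^sup>2"
      unfolding F_def w_def sum_divide_distrib
      by (intro sum.cong) (auto simp: power2_eq_square)
    have Nw: "N w = 1"
    proof -
      have "N w = (\<Sum>a\<in>I. (v a)\<^sup>2 / s\<^sup>2)"
        unfolding N_def w_def by (intro sum.cong) (auto simp: power_divide)
      also have "\<dots> = N v / s\<^sup>2" by (simp add: N_def sum_divide_distrib)
      finally show ?thesis using s False by simp
    qed
    have "w a \<in> {-1..1}" if "a \<in> I" for a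
    proof -
      have "(w a)\<^sup>2 \<le> N w"
        unfolding N_def using I that by (intro member_le_sum) auto
      then have "\<bar>w a\<bar> \<le> 1" by (simp add: Nw abs_square_le_1)
      then show ?thesis by auto
    qed
    then have "w \<in> K" using Nw by (auto simp: K_def PiE_iff w_def)
    then have "\<delta> \<le> F v / s\<^sup>2" using \<delta>(2) Fw by metis
    then show ?thesis using s Npos by (simp add: field_simps)
  qed
  then show ?thesis using \<delta>(1) unfolding F_def N_def by blast
qed

text \<open>
  A positive definite matrix is interior to the semidefinite cone: with \<open>B\<close> at least the sum of all
  \<open>\<bar>H a b\<bar>\<close>, the form of \<open>H\<close> is bounded by \<open>B \<bar>v\<bar>\<^sup>2\<close>, and coercivity
  absorbs a small multiple of that.
\<close>

lemma pd_on_perturbation: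
  fixes X H :: "'i \<Rightarrow> 'i \<Rightarrow> real"
  assumes I: "finite I" and pd: "pd_on I X"
  shows "\<exists>s>0. \<forall>t v. 0 \<le> t \<and> t \<le> s \<longrightarrow> 0 \<le> (\<Sum>a\<in>I. \<Sum>b\<in>I. v a * (X a b + t * H a b) * v b)"
proof -
  obtain \<delta> where \<delta>: "\<delta> > 0"
    "\<And>v. \<delta> * (\<Sum>a\<in>I. (v a)\<^sup>2) \<le> (\<Sum>a\<in>I. \<Sum>b\<in>I. v a * X a b * v b)"
    using pd_coercive[OF assms] by blast
  define B where "B = 1 + (\<Sum>a\<in>I. \<Sum>b\<in>I. \<bar>H a b\<bar>)"
  have B: "B > 0" unfolding B_def by (intro add_pos_nonneg sum_nonneg) auto
  have nonneg: "0 \<le> (\<Sum>a\<in>I. \<Sum>b\<in>I. v a * (X a b + t * H a b) * v b)" if t: "0 \<le> t" "t \<le> \<delta> / B" for t v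
  proof -
    let ?N = "\<Sum>a\<in>I. (v a)\<^sup>2" and ?H = "\<Sum>a\<in>I. \<Sum>b\<in>I. v a * H a b * v b"
    have prod: "\<bar>v a * v b\<bar> \<le> ?N" if "a \<in> I" "b \<in> I" for a b
    proof -
      have "(v a)\<^sup>2 \<le> ?N" "(v b)\<^sup>2 \<le> ?N"
        using that I by (auto intro!: member_le_sum)
      moreover have "2 * \<bar>v a * v b\<bar> \<le> (v a)\<^sup>2 + (v b)\<^sup>2"
        using sum_squares_bound[of "\<bar>v a\<bar>" "\<bar>v b\<bar>"] by (simp add: abs_mult)
      ultimately show ?thesis by simp
    qed
    have "\<bar>?H\<bar> \<le> (\<Sum>a\<in>I. \<Sum>b\<in>I. \<bar>v a * H a b * v b\<bar>)"
      by (intro order_trans[OF sum_abs] sum_mono sum_abs)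
    also have "\<dots> \<le> (\<Sum>a\<in>I. \<Sum>b\<in>I. \<bar>H a b\<bar> * ?N)"
    proof (intro sum_mono)
      fix a b assume ab: "a \<in> I" "b \<in> I"
      have "\<bar>v a * H a b * v b\<bar> = \<bar>H a b\<bar> * \<bar>v a * v b\<bar>"
        by (simp add: abs_mult)
      also have "\<dots> \<le> \<bar>H a b\<bar> * ?N"
        using prod[OF ab] by (intro mult_left_mono) auto
      finally show "\<bar>v a * H a b * v b\<bar> \<le> \<bar>H a b\<bar> * ?N" .
    qed
    also have "\<dots> = (\<Sum>a\<in>I. \<Sum>b\<in>I. \<bar>H a b\<bar>) * ?N"
      by (simp add: sum_distrib_right)
    also have "\<dots> \<le> B * ?N"
      by (intro mult_right_mono) (auto simp: B_def intro: sum_nonneg)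
    finally have "- (B * ?N) \<le> ?H" by linarith
    then have "t * - (B * ?N) \<le> t * ?H"
      using t(1) by (rule mult_left_mono)
    moreover have "t * (B * ?N) \<le> \<delta> / B * (B * ?N)"
      using t(2) B by (intro mult_right_mono mult_nonneg_nonneg sum_nonneg) auto
    moreover have "\<delta> / B * (B * ?N) = \<delta> * ?N"
      using B by simp
    ultimately have "0 \<le> \<delta> * ?N + t * ?H" by linarith
    also have "\<dots> \<le> (\<Sum>a\<in>I. \<Sum>b\<in>I. v a * X a b * v b) + t * ?H"
      using \<delta>(2) by simp
    also have "\<dots> = (\<Sum>a\<in>I. \<Sum>b\<in>I. v a * (X a b + t * H a b) * v b)"
      by (simp add: sum_distrib_left sum.distrib algebra_simps)
    finally show ?thesis .
  qed
  show ?thesis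
    using \<delta>(1) B nonneg by (intro exI[of _ "\<delta> / B"]) simp
qed

section \<open>Sums of squares\<close>

definition is_sos :: "'n set \<Rightarrow> 'n mpoly \<Rightarrow> bool" where
  "is_sos D p \<longleftrightarrow> (\<exists>(s::nat) q. (\<forall>j\<in>{1..s}. q j \<in> polys_in D) \<and> p = (\<Sum>j\<in>{1..s}. (q j)\<^sup>2))"

lemma is_sos_zero: "is_sos D 0"
  unfolding is_sos_def by (intro exI[of _ 0]) simp

lemma is_sos_square: "q \<in> polys_in D \<Longrightarrow> is_sos D (q\<^sup>2)"
  unfolding is_sos_def by (intro exI[of _ 1] exI[of _ "\<lambda>_. q"]) simp

lemma is_sos_add:
  assumes "is_sos D p" "is_sos D p'"
  shows "is_sos D (p + p')"
proof -
  obtain s q where q: "\<And>j. j \<in> {1..s::nat} \<Longrightarrow> q j \<in> polys_in D" "p = (\<Sum>j\<in>{1..s}. (q j)\<^sup>2)"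
    using assms(1) unfolding is_sos_def by blast
  obtain s' q' where q': "\<And>j. j \<in> {1..s'::nat} \<Longrightarrow> q' j \<in> polys_in D" "p' = (\<Sum>j\<in>{1..s'}. (q' j)\<^sup>2)"
    using assms(2) unfolding is_sos_def by blast
  define r where "r j = (if j \<le> s then q j else q' (j - s))" for j
  have "(\<Sum>j\<in>{1..s+s'}. (r j)\<^sup>2) = (\<Sum>j\<in>{1..s}. (r j)\<^sup>2) + (\<Sum>j\<in>{s+1..s+s'}. (r j)\<^sup>2)"
    by (subst sum.ub_add_nat) auto
  also have "(\<Sum>j\<in>{1..s}. (r j)\<^sup>2) = p"
    unfolding q(2) by (intro sum.cong) (auto simp: r_def)
  also have "(\<Sum>j\<in>{s+1..s+s'}. (r j)\<^sup>2) = p'"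
    unfolding q'(2) using sum.shift_bounds_cl_nat_ivl[of "\<lambda>j. (r j)\<^sup>2" 1 s s']
    by (simp add: add.commute r_def)
  finally have "p + p' = (\<Sum>j\<in>{1..s+s'}. (r j)\<^sup>2)" by simp
  moreover have "\<forall>j\<in>{1..s+s'}. r j \<in> polys_in D"
  proof
    fix j assume j: "j \<in> {1..s + s'}"
    show "r j \<in> polys_in D"
    proof (cases "j \<le> s")
      case False
      then have "j - s \<in> {1..s'}" using j by auto
      then show ?thesis using q'(1) False by (simp add: r_def)
    qed (use q(1)[of j] j in \<open>simp add: r_def\<close>)
  qed
  ultimately show ?thesis unfolding is_sos_def by blast
qed

lemma is_sos_sum: "(\<And>i. i \<in> I \<Longrightarrow> is_sos D (p i)) \<Longrightarrow> is_sos D (\<Sum>i\<in>I. p i)"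
  by (induction I rule: infinite_finite_induct) (auto simp: is_sos_zero is_sos_add)

lemma is_sos_eval_nonneg: "is_sos D p \<Longrightarrow> poly_eval p x \<ge> 0"
  unfolding is_sos_def by (auto intro!: sum_nonneg)

subsection \<open>The degree of a sum of squares\<close>

text \<open>
  Strict convexity of the Euclidean norm, in the form of the parallelogram identity
  \<open>\<bar>\<beta>\<bar>\<^sup>2 + \<bar>\<gamma>\<bar>\<^sup>2 = 2 \<bar>\<alpha>\<bar>\<^sup>2 + 2 \<bar>\<beta> - \<alpha>\<bar>\<^sup>2\<close> for the midpoint \<open>\<alpha>\<close> of \<open>\<beta>\<close> and \<open>\<gamma>\<close>.
\<close>

lemma midpoint_of_maximal_norm:
  fixes \<alpha> \<beta> \<gamma> :: "'n::finite mono"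
  defines "norm2 \<equiv> \<lambda>\<alpha> :: 'n mono. \<Sum>i\<in>UNIV. (int (Poly_Mapping.lookup \<alpha> i))\<^sup>2"
  assumes "\<beta> + \<gamma> = \<alpha> + \<alpha>" "norm2 \<beta> \<le> norm2 \<alpha>" "norm2 \<gamma> \<le> norm2 \<alpha>"
  shows "\<beta> = \<alpha>"
proof -
  let ?v = "\<lambda>\<alpha> i. int (Poly_Mapping.lookup \<alpha> i)"
  have mid: "?v \<gamma> i = 2 * ?v \<alpha> i - ?v \<beta> i" for i
    using arg_cong[OF assms(2), of "\<lambda>\<alpha>. Poly_Mapping.lookup \<alpha> i"] by (simp add: lookup_add)
  have "norm2 \<beta> + norm2 \<gamma> = (\<Sum>i\<in>UNIV. 2 * (?v \<alpha> i)\<^sup>2 + 2 * (?v \<beta> i - ?v \<alpha> i)\<^sup>2)"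
    unfolding norm2_def sum.distrib[symmetric] mid
    by (intro sum.cong) (auto simp: power2_eq_square algebra_simps)
  also have "\<dots> = 2 * norm2 \<alpha> + 2 * (\<Sum>i\<in>UNIV. (?v \<beta> i - ?v \<alpha> i)\<^sup>2)"
    by (simp add: sum.distrib sum_distrib_left norm2_def)
  finally have "(\<Sum>i\<in>UNIV. (?v \<beta> i - ?v \<alpha> i)\<^sup>2) \<le> 0"
    using assms(3,4) by simp
  then have "(\<Sum>i\<in>UNIV. (?v \<beta> i - ?v \<alpha> i)\<^sup>2) = 0"
    by (intro antisym) (simp_all add: sum_nonneg)
  then have "?v \<beta> i = ?v \<alpha> i" for i
    by (simp add: sum_nonneg_eq_0_iff)
  then show ?thesis by (intro poly_mapping_eqI) simp
qed

lemma lookup_eq_riesz: "Poly_Mapping.lookup p \<gamma> = riesz (\<lambda>\<beta>. if \<beta> = \<gamma> then 1 else 0) p"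
  by (simp add: riesz_def if_distrib in_keys_iff cong: if_cong)

text \<open>
  Leading terms of squares cannot cancel. Among the exponents of maximal degree take one, \<open>\<alpha>\<close>, of
  maximal Euclidean norm: it is an extreme point of the set of all exponents, so \<open>2\<alpha>\<close> arises in
  each square only as \<open>\<alpha> + \<alpha>\<close>, and its coefficient is a sum of squares that is not zero.
\<close>

lemma poly_deg_summand_of_squares:
  fixes q :: "'j \<Rightarrow> 'n::finite mpoly"
  assumes J: "finite J" and deg: "poly_deg (\<Sum>j\<in>J. (q j)\<^sup>2) \<le> 2 * k" and j: "j \<in> J"
  shows "poly_deg (q j) \<le> k"
proof (rule ccontr)
  define S where "S = (\<Union>j\<in>J. Poly_Mapping.keys (q j))"
  define norm2 where "norm2 \<alpha> = (\<Sum>i\<in>UNIV. (int (Poly_Mapping.lookup \<alpha> i))\<^sup>2)" for \<alpha> :: "'n mono"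
  define d where "d = Max (mono_deg ` S)"
  define T where "T = {\<alpha> \<in> S. mono_deg \<alpha> = d}"
  assume "\<not> poly_deg (q j) \<le> k"
  then obtain \<alpha>0 where \<alpha>0: "\<alpha>0 \<in> Poly_Mapping.keys (q j)" "mono_deg \<alpha>0 > k"
    by (auto simp: poly_deg_le_iff not_le)
  then have S: "finite S" "\<alpha>0 \<in> S" using J j by (auto simp: S_def)
  have le_d: "mono_deg \<beta> \<le> d" if "\<beta> \<in> S" for \<beta>
    using that S by (simp add: d_def)
  have dk: "d > k" using le_d[OF S(2)] \<alpha>0(2) by simp
  have "d \<in> mono_deg ` S" unfolding d_def using S by (intro Max_in) auto
  then have T: "finite T" "T \<noteq> {}" using S by (auto simp: T_def)
  have "Max (norm2 ` T) \<in> norm2 ` T" using T by (intro Max_in) auto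
  then obtain \<alpha> where \<alpha>: "\<alpha> \<in> T" "norm2 \<alpha> = Max (norm2 ` T)" by auto
  have norm_le: "norm2 \<beta> \<le> norm2 \<alpha>" if "\<beta> \<in> T" for \<beta>
    unfolding \<alpha>(2) using that T by simp
  have unique: "\<beta> = \<alpha> \<and> \<gamma> = \<alpha>" if "\<beta> \<in> S" "\<gamma> \<in> S" "\<beta> + \<gamma> = \<alpha> + \<alpha>" for \<beta> \<gamma>
  proof -
    have "mono_deg \<beta> + mono_deg \<gamma> = 2 * d"
      using arg_cong[OF that(3), of mono_deg] \<alpha>(1) by (simp add: mono_deg_add T_def)
    then have "\<beta> \<in> T" "\<gamma> \<in> T"
      using le_d[OF that(1)] le_d[OF that(2)] that by (auto simp: T_def)
    then have "norm2 \<beta> \<le> norm2 \<alpha>" "norm2 \<gamma> \<le> norm2 \<alpha>" by (auto intro: norm_le)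
    then have "\<beta> = \<alpha>"
      using midpoint_of_maximal_norm[OF that(3)] unfolding norm2_def by blast
    then show ?thesis using that(3) by simp
  qed
  have coeff: "Poly_Mapping.lookup ((q i)\<^sup>2) (\<alpha> + \<alpha>) = (Poly_Mapping.lookup (q i) \<alpha>)\<^sup>2" if "i \<in> J" for i
  proof -
    let ?K = "Poly_Mapping.keys (q i)"
    have "?K \<subseteq> S" using that by (auto simp: S_def)
    have "Poly_Mapping.lookup ((q i)\<^sup>2) (\<alpha> + \<alpha>) = (\<Sum>\<beta>\<in>?K. \<Sum>\<gamma>\<in>?K.
        Poly_Mapping.lookup (q i) \<beta> * Poly_Mapping.lookup (q i) \<gamma> * (if \<beta> + \<gamma> = \<alpha> + \<alpha> then 1 else 0))"
      unfolding lookup_eq_riesz[of "(q i)\<^sup>2"] unfolding power2_eq_square riesz_mult by (rule refl)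
    also have "\<dots> = (\<Sum>\<beta>\<in>?K. \<Sum>\<gamma>\<in>?K. if \<gamma> = \<alpha> then (if \<beta> = \<alpha> then (Poly_Mapping.lookup (q i) \<alpha>)\<^sup>2 else 0) else 0)"
    proof (intro sum.cong refl)
      fix \<beta> \<gamma> assume "\<beta> \<in> ?K" "\<gamma> \<in> ?K"
      then have "\<beta> + \<gamma> = \<alpha> + \<alpha> \<longleftrightarrow> \<beta> = \<alpha> \<and> \<gamma> = \<alpha>"
        using unique \<open>?K \<subseteq> S\<close> by blast
      then show "Poly_Mapping.lookup (q i) \<beta> * Poly_Mapping.lookup (q i) \<gamma> * (if \<beta> + \<gamma> = \<alpha> + \<alpha> then 1 else 0)
          = (if \<gamma> = \<alpha> then (if \<beta> = \<alpha> then (Poly_Mapping.lookup (q i) \<alpha>)\<^sup>2 else 0) else 0)"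
        by (simp add: power2_eq_square)
    qed
    also have "\<dots> = (Poly_Mapping.lookup (q i) \<alpha>)\<^sup>2"
      by (cases "Poly_Mapping.lookup (q i) \<alpha> = 0") (simp_all add: in_keys_iff)
    finally show ?thesis .
  qed
  obtain i where i: "i \<in> J" "\<alpha> \<in> Poly_Mapping.keys (q i)"
    using \<alpha>(1) by (auto simp: T_def S_def)
  have "Poly_Mapping.lookup (\<Sum>j\<in>J. (q j)\<^sup>2) (\<alpha> + \<alpha>) = (\<Sum>j\<in>J. (Poly_Mapping.lookup (q j) \<alpha>)\<^sup>2)"
    by (simp add: lookup_sum coeff)
  moreover have "\<dots> > 0"
    using i J by (intro sum_pos2[of J i]) (auto simp: in_keys_iff)
  ultimately have "\<alpha> + \<alpha> \<in> Poly_Mapping.keys (\<Sum>j\<in>J. (q j)\<^sup>2)"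
    by (simp add: in_keys_iff)
  then have "mono_deg (\<alpha> + \<alpha>) \<le> 2 * k"
    using deg by (simp add: poly_deg_le_iff)
  then show False
    using \<alpha>(1) dk by (simp add: mono_deg_add T_def)
qed

section \<open>The first-order remainder of an SOS-convex polynomial\<close>

definition tangent :: "'n::finite mpoly \<Rightarrow> real ^ 'n \<Rightarrow> 'n mpoly" where
  "tangent p a = const_poly (poly_eval p a) +
     (\<Sum>j\<in>UNIV. const_poly (poly_eval (partial j p) a) * (coord_poly j - const_poly (a $ j)))"

lemma poly_eval_tangent:
  "poly_eval (tangent p a) x =
     poly_eval p a + (\<Sum>j\<in>UNIV. poly_eval (partial j p) a * (x $ j - a $ j))"
  by (simp add: tangent_def)

text \<open>
  Along the segment from \<open>a\<close> to \<open>x\<close>, a polynomial becomes a polynomial in the parameter \<open>s\<close> whose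
  coefficients are polynomials in \<open>x\<close>. The coefficients are defined for every \<open>d\<close> and vanish beyond \<open>N\<close>,
  so that expansions of different lengths can be added and multiplied.
\<close>

definition line_expansion ::
  "'n set \<Rightarrow> nat \<Rightarrow> (nat \<Rightarrow> 'n::finite mpoly) \<Rightarrow> (real \<Rightarrow> real ^ 'n \<Rightarrow> real) \<Rightarrow> bool" where
  "line_expansion D N r F \<longleftrightarrow> (\<forall>d. r d \<in> polys_in D) \<and> (\<forall>d>N. r d = 0) \<and>
     (\<forall>s x. F s x = (\<Sum>d\<le>N. poly_eval (r d) x * s ^ d))"

lemma line_expansion_static:
  "q \<in> polys_in D \<Longrightarrow> \<exists>N r. line_expansion D N r (\<lambda>s x. poly_eval q x)"
  unfolding line_expansion_def
  by (intro exI[of _ 0] exI[of _ "\<lambda>d. if d = 0 then q else 0"]) (auto simp: polys_in_zero)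

lemma line_expansion_affine:
  assumes "q \<in> polys_in D" "q' \<in> polys_in D"
  shows "\<exists>N r. line_expansion D N r (\<lambda>s x. poly_eval q x + s * poly_eval q' x)"
  unfolding line_expansion_def using assms
  by (intro exI[of _ 1] exI[of _ "\<lambda>d. if d = 0 then q else if d = 1 then q' else 0"])
     (auto simp: polys_in_zero)

lemma line_expansion_mono:
  assumes "line_expansion D N r F" "N \<le> M"
  shows "line_expansion D M r F"
proof -
  have "(\<Sum>d\<le>N. poly_eval (r d) x * s ^ d) = (\<Sum>d\<le>M. poly_eval (r d) x * s ^ d)" for s x
    using assms by (intro sum.mono_neutral_left) (auto simp: line_expansion_def)
  then show ?thesis using assms by (auto simp: line_expansion_def)
qed

lemma line_expansion_add:
  assumes "\<exists>N r. line_expansion D N r F" "\<exists>N r. line_expansion D N r F'"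
  shows "\<exists>N r. line_expansion D N r (\<lambda>s x. F s x + F' s x)"
proof -
  obtain N r N' r' where "line_expansion D N r F" "line_expansion D N' r' F'"
    using assms by blast
  then have "line_expansion D (max N N') r F" "line_expansion D (max N N') r' F'"
    by (auto intro: line_expansion_mono)
  then have "line_expansion D (max N N') (\<lambda>d. r d + r' d) (\<lambda>s x. F s x + F' s x)"
    by (auto simp: line_expansion_def polys_in_add sum.distrib distrib_right)
  then show ?thesis by blast
qed

lemma line_expansion_sum:
  assumes "\<And>i. i \<in> I \<Longrightarrow> \<exists>N r. line_expansion D N r (F i)"
  shows "\<exists>N r. line_expansion D N r (\<lambda>s x. \<Sum>i\<in>I. F i s x)"
  using assms
proof (induction I rule: infinite_finite_induct)
  case (insert i I)
  then have "\<exists>N r. line_expansion D N r (\<lambda>s x. F i s x + (\<Sum>i\<in>I. F i s x))"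
    by (intro line_expansion_add) auto
  then show ?case using insert.hyps by simp
qed (use line_expansion_static[OF polys_in_zero] in auto)

lemma line_expansion_mult:
  assumes "\<exists>N r. line_expansion D N r F" "\<exists>N r. line_expansion D N r F'"
  shows "\<exists>N r. line_expansion D N r (\<lambda>s x. F s x * F' s x)"
proof -
  obtain N r N' r' where r: "line_expansion D N r F" and r': "line_expansion D N' r' F'"
    using assms by blast
  have "(\<Sum>k\<le>d. r k * r' (d - k)) = 0" if "d > N + N'" for d
  proof (rule sum.neutral, rule ballI)
    fix k assume "k \<in> {..d}"
    then show "r k * r' (d - k) = 0"
      using r r' that by (cases "k > N") (auto simp: line_expansion_def)
  qed
  moreover have "F s x * F' s x = (\<Sum>d\<le>N+N'. poly_eval (\<Sum>k\<le>d. r k * r' (d - k)) x * s ^ d)" for s x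
    using polynomial_product[of N "\<lambda>d. poly_eval (r d) x" N' "\<lambda>d. poly_eval (r' d) x" s] r r'
    by (simp add: line_expansion_def)
  ultimately have "line_expansion D (N + N') (\<lambda>d. \<Sum>k\<le>d. r k * r' (d - k)) (\<lambda>s x. F s x * F' s x)"
    using r r' by (auto simp: line_expansion_def intro!: polys_in_sum polys_in_mult)
  then show ?thesis by blast
qed

lemma line_expansion_one: "\<exists>N r. line_expansion D N r (\<lambda>s x. 1)"
  using line_expansion_static[OF polys_in_const[of 1]] by simp

lemma line_expansion_prod:
  assumes "\<And>i. i \<in> I \<Longrightarrow> \<exists>N r. line_expansion D N r (F i)"
  shows "\<exists>N r. line_expansion D N r (\<lambda>s x. \<Prod>i\<in>I. F i s x)"
  using assms
proof (induction I rule: infinite_finite_induct)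
  case (insert i I)
  then have "\<exists>N r. line_expansion D N r (\<lambda>s x. F i s x * (\<Prod>i\<in>I. F i s x))"
    by (intro line_expansion_mult) auto
  then show ?case using insert.hyps by simp
qed (use line_expansion_one in auto)

lemma line_expansion_poly_eval:
  assumes q: "q \<in> polys_in D"
  shows "\<exists>N r. line_expansion D N r (\<lambda>s x. poly_eval q (a + s *\<^sub>R (x - a)))"
proof -
  have coord: "\<exists>N r. line_expansion D N r (\<lambda>s x. (a + s *\<^sub>R (x - a)) $ j)" if "j \<in> D" for j
    using line_expansion_affine[of "const_poly (a $ j)" D "coord_poly j - const_poly (a $ j)"] that
    by (simp add: polys_in_const polys_in_diff polys_in_coord)
  have "\<exists>N r. line_expansion D N r (\<lambda>s x. mono_eval \<alpha> (a + s *\<^sub>R (x - a)))"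
    if \<alpha>: "\<alpha> \<in> Poly_Mapping.keys q" for \<alpha>
    unfolding mono_eval_def
  proof (rule line_expansion_prod)
    fix j
    show "\<exists>N r. line_expansion D N r (\<lambda>s x. (a + s *\<^sub>R (x - a)) $ j ^ Poly_Mapping.lookup \<alpha> j)"
    proof (cases "j \<in> D")
      case True
      have "\<exists>N r. line_expansion D N r (\<lambda>s x. \<Prod>i<Poly_Mapping.lookup \<alpha> j. (a + s *\<^sub>R (x - a)) $ j)"
        using coord[OF True] by (intro line_expansion_prod)
      then show ?thesis by simp
    next
      case False
      then have "Poly_Mapping.lookup \<alpha> j = 0"
        using q \<alpha> by (intro polys_in_lookup_zero)
      then show ?thesis using line_expansion_one by simp
    qed
  qed
  then have "\<exists>N r. line_expansion D N r (\<lambda>s x. \<Sum>\<alpha>\<in>Poly_Mapping.keys q.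
      Poly_Mapping.lookup q \<alpha> * mono_eval \<alpha> (a + s *\<^sub>R (x - a)))"
    using line_expansion_static[OF polys_in_const]
    by (intro line_expansion_sum line_expansion_mult) simp_all
  then show ?thesis by (simp add: poly_eval_riesz riesz_def)
qed

lemma sum_swap_third:
  "(\<Sum>a\<in>A. \<Sum>b\<in>B. \<Sum>c\<in>C. f a b c) = (\<Sum>c\<in>C. \<Sum>a\<in>A. \<Sum>b\<in>B. f a b c)"
proof -
  have "(\<Sum>a\<in>A. \<Sum>b\<in>B. \<Sum>c\<in>C. f a b c) = (\<Sum>a\<in>A. \<Sum>c\<in>C. \<Sum>b\<in>B. f a b c)"
    by (intro sum.cong refl sum.swap)
  also have "\<dots> = (\<Sum>c\<in>C. \<Sum>a\<in>A. \<Sum>b\<in>B. f a b c)"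
    by (rule sum.swap)
  finally show ?thesis .
qed

text \<open>
  The Hankel matrix of the moments of the measure \<open>(1 - s) ds\<close> on \<open>[0, 1]\<close>, the weight in Taylor's
  formula, is semidefinite. Its factorization turns an integral of squares of polynomials in \<open>s\<close> into a
  finite sum of squares of combinations of their coefficients.
\<close>

lemma taylor_gram_factorization:
  "\<exists>(R::nat) z. \<forall>d\<le>N. \<forall>e\<le>N.
     integral {0..1::real} (\<lambda>s. (1 - s) * s ^ (d + e)) = (\<Sum>k\<in>{1..R}. z k d * z k e)"
proof -
  define M where "M d e = integral {0..1::real} (\<lambda>s. (1 - s) * s ^ (d + e))" for d e
  have int: "(\<lambda>s. (1 - s) * s ^ (d + e)) integrable_on {0..1::real}" for d e
    by (intro integrable_continuous_interval continuous_intros)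
  have "psd_on {..N} M"
    unfolding psd_on_def
  proof (intro conjI ballI allI)
    show "M d e = M e d" for d e by (simp add: M_def add.commute)
    fix v :: "nat \<Rightarrow> real"
    have "((\<lambda>s. \<Sum>d\<le>N. \<Sum>e\<le>N. (v d * v e) * ((1 - s) * s ^ (d + e))) has_integral
        (\<Sum>d\<le>N. \<Sum>e\<le>N. (v d * v e) * M d e)) {0..1}"
      unfolding M_def
      by (intro has_integral_sum has_integral_mult_right integrable_integral int) auto
    then have "(\<Sum>d\<le>N. \<Sum>e\<le>N. v d * M d e * v e) =
        integral {0..1} (\<lambda>s. \<Sum>d\<le>N. \<Sum>e\<le>N. (v d * v e) * ((1 - s) * s ^ (d + e)))"
      by (simp add: integral_unique mult_ac)
    also have "\<dots> = integral {0..1} (\<lambda>s. (1 - s) * (\<Sum>d\<le>N. v d * s ^ d)\<^sup>2)"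
      by (simp add: power2_eq_square sum_product sum_distrib_left power_add mult_ac)
    also have "\<dots> \<ge> 0"
      by (intro integral_nonneg integrable_continuous_interval continuous_intros) auto
    finally show "0 \<le> (\<Sum>d\<le>N. \<Sum>e\<le>N. v d * M d e * v e)" .
  qed
  from psd_factorization[OF _ this] show ?thesis unfolding M_def by fastforce
qed

text \<open>
  On the segment from \<open>a\<close> to \<open>x\<close>, Taylor's formula writes the remainder as
  \<open>\<integral> (1 - s) \<Sum>\<^sub>c (W c s x)\<^sup>2 ds\<close> with \<open>W c s x\<close> the \<open>c\<close>-th row of \<open>Q(a + s (x - a))\<close> applied to
  \<open>x - a\<close>. Each \<open>W c\<close> is polynomial in \<open>s\<close> and \<open>x\<close>, so the factorized moment matrix of the weight
  replaces the integral by a finite sum of squares of polynomials in \<open>x\<close> alone.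
\<close>

theorem sos_convex_remainder_is_sos:
  fixes p :: "'n::finite mpoly" and Q :: "nat \<Rightarrow> 'n \<Rightarrow> 'n mpoly"
  assumes p: "p \<in> polys_in D"
    and Q: "\<And>c j. c \<in> {1..r} \<Longrightarrow> j \<in> D \<Longrightarrow> Q c j \<in> polys_in D"
    and hess: "\<And>i j. i \<in> D \<Longrightarrow> j \<in> D \<Longrightarrow> partial i (partial j p) = (\<Sum>c\<in>{1..r}. Q c i * Q c j)"
  shows "is_sos D (p - tangent p a)"
proof -
  define W where "W c s x = (\<Sum>i\<in>D. poly_eval (Q c i) (a + s *\<^sub>R (x - a)) * (x $ i - a $ i))" for c s x
  have "\<exists>N w. line_expansion D N w (W c)" if "c \<in> {1..r}" for c
  proof -
    have "\<exists>N w. line_expansion D N w (\<lambda>s x. x $ i - a $ i)" if "i \<in> D" for i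
      using line_expansion_static[of "coord_poly i - const_poly (a $ i)" D] that
      by (simp add: polys_in_const polys_in_diff polys_in_coord)
    then have "\<exists>N w. line_expansion D N w
        (\<lambda>s x. \<Sum>i\<in>D. poly_eval (Q c i) (a + s *\<^sub>R (x - a)) * (x $ i - a $ i))"
      using that Q by (intro line_expansion_sum line_expansion_mult line_expansion_poly_eval)
    moreover have "W c = (\<lambda>s x. \<Sum>i\<in>D. poly_eval (Q c i) (a + s *\<^sub>R (x - a)) * (x $ i - a $ i))"
      by (simp add: W_def fun_eq_iff)
    ultimately show ?thesis by simp
  qed
  then obtain N w where Nw: "\<And>c. c \<in> {1..r} \<Longrightarrow> line_expansion D (N c) (w c) (W c)"
    by metis
  define M where "M d e = integral {0..1::real} (\<lambda>s. (1 - s) * s ^ (d + e))" for d e :: nat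
  have "\<exists>(R::nat) z. \<forall>d\<le>N c. \<forall>e\<le>N c. M d e = (\<Sum>k\<in>{1..R}. z k d * z k e)" for c
    using taylor_gram_factorization[of "N c"] unfolding M_def by blast
  then obtain R :: "nat \<Rightarrow> nat" and z where
    Rz: "\<And>c d e. d \<le> N c \<Longrightarrow> e \<le> N c \<Longrightarrow> M d e = (\<Sum>k\<in>{1..R c}. z c k d * z c k e)"
    by metis
  define h where "h c k = (\<Sum>d\<le>N c. const_poly (z c k d) * w c d)" for c k
  have "poly_eval (p - tangent p a) x = poly_eval (\<Sum>c\<in>{1..r}. \<Sum>k\<in>{1..R c}. (h c k)\<^sup>2) x" for x
  proof -
    define y where "y = x - a"
    define Df where "Df n t = (if n = 0 then poly_eval p (a + t *\<^sub>R y)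
      else if n = 1 then \<Sum>j\<in>UNIV. y $ j * poly_eval (partial j p) (a + t *\<^sub>R y)
      else \<Sum>c\<in>{1..r}. (W c t x)\<^sup>2)" for n :: nat and t
    have Df: "Df 0 = (\<lambda>t. poly_eval p (a + t *\<^sub>R y))"
      "Df (Suc 0) = (\<lambda>t. \<Sum>j\<in>UNIV. y $ j * poly_eval (partial j p) (a + t *\<^sub>R y))"
      "Df (Suc (Suc 0)) = (\<lambda>t. \<Sum>c\<in>{1..r}. (W c t x)\<^sup>2)"
      by (simp_all add: Df_def fun_eq_iff)
    have second: "(\<Sum>j\<in>UNIV. y $ j * (\<Sum>i\<in>UNIV. y $ i * poly_eval (partial i (partial j p)) (a + t *\<^sub>R y)))
        = (\<Sum>c\<in>{1..r}. (W c t x)\<^sup>2)" for t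
    proof -
      have zero: "partial i (partial j p) = 0" if "i \<notin> D \<or> j \<notin> D" for i j
        using that p partial_eq_zero[OF polys_in_partial[OF p]]
        by (cases "j \<in> D") (auto simp: partial_eq_zero partial_def[of _ 0])
      have "(\<Sum>j\<in>UNIV. y $ j * (\<Sum>i\<in>UNIV. y $ i * poly_eval (partial i (partial j p)) (a + t *\<^sub>R y)))
        = (\<Sum>j\<in>UNIV. \<Sum>i\<in>UNIV. y $ j * (y $ i * poly_eval (partial i (partial j p)) (a + t *\<^sub>R y)))"
        by (simp add: sum_distrib_left)
      also have "\<dots> = (\<Sum>j\<in>D. \<Sum>i\<in>UNIV. y $ j * (y $ i * poly_eval (partial i (partial j p)) (a + t *\<^sub>R y)))"
        by (rule sum.mono_neutral_right) (simp_all add: zero)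
      also have "\<dots> = (\<Sum>j\<in>D. \<Sum>i\<in>D. y $ j * (y $ i * poly_eval (partial i (partial j p)) (a + t *\<^sub>R y)))"
        by (intro sum.cong refl sum.mono_neutral_right) (simp_all add: zero)
      also have "\<dots> = (\<Sum>j\<in>D. \<Sum>i\<in>D. \<Sum>c\<in>{1..r}.
          (poly_eval (Q c j) (a + t *\<^sub>R y) * y $ j) * (poly_eval (Q c i) (a + t *\<^sub>R y) * y $ i))"
        by (intro sum.cong refl) (simp add: hess sum_distrib_left mult_ac)
      also have "\<dots> = (\<Sum>c\<in>{1..r}. \<Sum>j\<in>D. \<Sum>i\<in>D.
          (poly_eval (Q c j) (a + t *\<^sub>R y) * y $ j) * (poly_eval (Q c i) (a + t *\<^sub>R y) * y $ i))"
        by (rule sum_swap_third)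
      also have "\<dots> = (\<Sum>c\<in>{1..r}. (W c t x)\<^sup>2)"
        unfolding W_def power2_eq_square sum_product y_def by simp
      finally show ?thesis .
    qed
    have deriv: "(Df n has_vector_derivative Df (Suc n) t) (at t within {0..1})" if "n < 2" for n t
    proof -
      have "(Df n has_real_derivative Df (Suc n) t) (at t)"
      proof (cases "n = 0")
        case True
        then show ?thesis
          using poly_eval_has_derivative_on_line[of p a y t] by (simp add: Df)
      next
        case False
        with that have "n = Suc 0" by simp
        then show ?thesis
          unfolding \<open>n = Suc 0\<close> Df second[symmetric]
          by (intro DERIV_sum DERIV_cmult poly_eval_has_derivative_on_line)
      qed
      then show ?thesis
        by (simp add: has_real_derivative_iff_has_vector_derivative has_vector_derivative_at_within)
    qed
    have taylor: "((\<lambda>s. (1 - s) * (\<Sum>c\<in>{1..r}. (W c s x)\<^sup>2)) has_integral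
        poly_eval p (a + y) - (poly_eval p a + (\<Sum>j\<in>UNIV. y $ j * poly_eval (partial j p) a))) {0..1}"
      using Taylor_has_integral[of 2 Df "Df 0" 0 1] deriv
      by (simp add: Df numeral_2_eq_2)
    have expand: "(\<lambda>s. (1 - s) * (\<Sum>c\<in>{1..r}. (W c s x)\<^sup>2)) =
        (\<lambda>s. \<Sum>c\<in>{1..r}. \<Sum>d\<le>N c. \<Sum>e\<le>N c.
           (poly_eval (w c d) x * poly_eval (w c e) x) * ((1 - s) * s ^ (d + e)))"
    proof
      fix s
      show "(1 - s) * (\<Sum>c\<in>{1..r}. (W c s x)\<^sup>2) = (\<Sum>c\<in>{1..r}. \<Sum>d\<le>N c. \<Sum>e\<le>N c.
           (poly_eval (w c d) x * poly_eval (w c e) x) * ((1 - s) * s ^ (d + e)))"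
        unfolding sum_distrib_left
      proof (rule sum.cong, simp)
        fix c assume "c \<in> {1..r}"
        then have "W c s x = (\<Sum>d\<le>N c. poly_eval (w c d) x * s ^ d)"
          using Nw by (simp add: line_expansion_def)
        then show "(1 - s) * (W c s x)\<^sup>2 = (\<Sum>d\<le>N c. \<Sum>e\<le>N c.
           (poly_eval (w c d) x * poly_eval (w c e) x) * ((1 - s) * s ^ (d + e)))"
          by (simp add: power2_eq_square sum_product sum_distrib_left power_add mult_ac)
      qed
    qed
    have "((\<lambda>s. \<Sum>c\<in>{1..r}. \<Sum>d\<le>N c. \<Sum>e\<le>N c.
           (poly_eval (w c d) x * poly_eval (w c e) x) * ((1 - s) * s ^ (d + e))) has_integral
        (\<Sum>c\<in>{1..r}. \<Sum>d\<le>N c. \<Sum>e\<le>N c. (poly_eval (w c d) x * poly_eval (w c e) x) * M d e)) {0..1::real}"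
      unfolding M_def
      by (intro has_integral_sum has_integral_mult_right integrable_integral
          integrable_continuous_interval continuous_intros) auto
    then have "poly_eval p (a + y) - (poly_eval p a + (\<Sum>j\<in>UNIV. y $ j * poly_eval (partial j p) a))
        = (\<Sum>c\<in>{1..r}. \<Sum>d\<le>N c. \<Sum>e\<le>N c. (poly_eval (w c d) x * poly_eval (w c e) x) * M d e)"
      using taylor unfolding expand by (rule has_integral_unique[rotated])
    also have "\<dots> = (\<Sum>c\<in>{1..r}. \<Sum>k\<in>{1..R c}. (poly_eval (h c k) x)\<^sup>2)"
    proof (rule sum.cong, simp)
      fix c
      have "(\<Sum>d\<le>N c. \<Sum>e\<le>N c. (poly_eval (w c d) x * poly_eval (w c e) x) * M d e) =
          (\<Sum>d\<le>N c. \<Sum>e\<le>N c. \<Sum>k\<in>{1..R c}.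
             (z c k d * poly_eval (w c d) x) * (z c k e * poly_eval (w c e) x))"
        by (intro sum.cong refl) (simp add: Rz sum_distrib_left mult_ac)
      also have "\<dots> = (\<Sum>k\<in>{1..R c}. \<Sum>d\<le>N c. \<Sum>e\<le>N c.
             (z c k d * poly_eval (w c d) x) * (z c k e * poly_eval (w c e) x))"
        by (rule sum_swap_third)
      finally show "(\<Sum>d\<le>N c. \<Sum>e\<le>N c. (poly_eval (w c d) x * poly_eval (w c e) x) * M d e) =
          (\<Sum>k\<in>{1..R c}. (poly_eval (h c k) x)\<^sup>2)"
        by (simp add: h_def power2_eq_square sum_product)
    qed
    finally show ?thesis
      by (simp add: poly_eval_tangent y_def mult.commute)
  qed
  then have "p - tangent p a = (\<Sum>c\<in>{1..r}. \<Sum>k\<in>{1..R c}. (h c k)\<^sup>2)"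
    by (rule poly_eval_eq_imp_eq)
  moreover have "h c k \<in> polys_in D" if "c \<in> {1..r}" for c k
    using Nw[OF that] unfolding h_def line_expansion_def
    by (intro polys_in_sum polys_in_mult polys_in_const) auto
  ultimately show ?thesis by (auto intro!: is_sos_sum is_sos_square)
qed

text \<open>
  SOS-convexity of a single polynomial, so that the objectives \<open>f i\<close> and the negated constraints
  \<open>- \<xi>\<^sup>T G \<xi>\<close> with \<open>\<xi>\<close> fixed become instances of one notion.
\<close>

definition sos_hessian :: "'n set \<Rightarrow> 'n mpoly \<Rightarrow> bool" where
  "sos_hessian D p \<longleftrightarrow> (\<exists>(r::nat) (Q :: nat \<Rightarrow> 'n \<Rightarrow> 'n mpoly).
     (\<forall>c\<in>{1..r}. \<forall>j\<in>D. Q c j \<in> polys_in D) \<and>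
     (\<forall>i\<in>D. \<forall>j\<in>D. partial i (partial j p) = (\<Sum>c\<in>{1..r}. Q c i * Q c j)))"

lemma sos_convex_mat_iff: "sos_convex_mat D l P \<longleftrightarrow> (\<forall>\<xi>. sos_hessian D (quad_form l P \<xi>))"
  unfolding sos_convex_mat_def sos_hessian_def ..

lemma sos_convex_imp_sos_hessian:
  assumes "sos_convex D p"
  shows "sos_hessian D p"
proof -
  have "quad_form 1 (\<lambda>_ _. p) (\<lambda>_. 1) = p"
    by (simp add: quad_form_def const_poly_def)
  then show ?thesis
    using assms unfolding sos_convex_def sos_convex_mat_iff by metis
qed

lemma quad_form_uminus: "quad_form l (\<lambda>a b. - P a b) \<xi> = - quad_form l P \<xi>"
  by (simp add: quad_form_def sum_negf)

lemma sos_concave_imp_sos_hessian: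
  "sos_concave_mat D l P \<Longrightarrow> sos_hessian D (- quad_form l P \<xi>)"
  unfolding sos_concave_mat_def sos_convex_mat_iff quad_form_uminus by blast

lemma poly_eval_quad_form:
  "poly_eval (quad_form l P \<xi>) x = (\<Sum>a\<in>{1..l}. \<Sum>b\<in>{1..l}. \<xi> a * poly_eval (P a b) x * \<xi> b)"
  by (simp add: quad_form_def)

lemma polys_in_quad_form:
  "(\<And>a b. a \<in> {1..l} \<Longrightarrow> b \<in> {1..l} \<Longrightarrow> P a b \<in> polys_in D) \<Longrightarrow> quad_form l P \<xi> \<in> polys_in D"
  unfolding quad_form_def by (intro polys_in_sum polys_in_mult polys_in_const)

lemma poly_deg_quad_form:
  assumes "\<And>a b. a \<in> {1..l} \<Longrightarrow> b \<in> {1..l} \<Longrightarrow> poly_deg (P a b) \<le> d"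
  shows "poly_deg (quad_form l P \<xi>) \<le> d"
  unfolding quad_form_def
proof (intro poly_deg_sum)
  fix a b assume "a \<in> {1..l}" "b \<in> {1..l}"
  then show "poly_deg (const_poly (\<xi> a) * P a b * const_poly (\<xi> b)) \<le> d"
    using poly_deg_mult[of "const_poly (\<xi> a) * P a b" d "const_poly (\<xi> b)" 0]
      poly_deg_mult[of "const_poly (\<xi> a)" 0 "P a b" d] assms by simp
qed

lemma poly_deg_tangent: "poly_deg (tangent p a) \<le> 1"
  unfolding tangent_def
proof (intro poly_deg_add poly_deg_sum)
  fix j
  have "poly_deg (coord_poly j - const_poly (a $ j)) \<le> 1"
    using poly_deg_mono[of "unit_mono j"] by (intro poly_deg_diff) simp_all
  then show "poly_deg (const_poly (poly_eval (partial j p) a) * (coord_poly j - const_poly (a $ j))) \<le> 1"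
    using poly_deg_mult[of "const_poly (poly_eval (partial j p) a)" 0 _ 1] by simp
qed simp

lemma sos_hessian_remainder:
  "p \<in> polys_in D \<Longrightarrow> sos_hessian D p \<Longrightarrow> is_sos D (p - tangent p a)"
  unfolding sos_hessian_def by (blast intro: sos_convex_remainder_is_sos)

text \<open>The remainder at every base point is a sum of squares, so each tangent is a global lower bound.\<close>

lemma sos_hessian_imp_convex_on:
  assumes "p \<in> polys_in D" "sos_hessian D p"
  shows "convex_on UNIV (poly_eval p)"
  unfolding convex_on_def
proof (intro conjI ballI allI impI)
  fix x z :: "real ^ 'a" and s t :: real
  assume st: "0 \<le> s" "0 \<le> t" "s + t = 1"
  define a where "a = s *\<^sub>R x + t *\<^sub>R z"
  define g where "g = (\<chi> j. poly_eval (partial j p) a)"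
  have lower: "poly_eval p a + inner g (w - a) \<le> poly_eval p w" for w
    using is_sos_eval_nonneg[OF sos_hessian_remainder[OF assms, of a], of w]
    by (simp add: poly_eval_tangent inner_vec_def g_def)
  have "s *\<^sub>R (x - a) + t *\<^sub>R (z - a) = a - (s + t) *\<^sub>R a"
    by (simp add: a_def algebra_simps)
  then have "s * inner g (x - a) + t * inner g (z - a) = 0"
    using st by (simp flip: inner_scaleR_right inner_add_right)
  moreover have "s * poly_eval p a + t * poly_eval p a = poly_eval p a"
    using st by (simp flip: distrib_right)
  ultimately show "poly_eval p (s *\<^sub>R x + t *\<^sub>R z) \<le> s * poly_eval p x + t * poly_eval p z"
    using mult_left_mono[OF lower[of x] st(1)] mult_left_mono[OF lower[of z] st(2)]
    by (simp add: a_def[symmetric] algebra_simps)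
qed simp

section \<open>Pseudo-moments\<close>

lemma riesz_const_mult: "riesz y (const_poly c * p) = c * riesz y p"
  by (cases "c = 0") (simp_all add: riesz_mult const_poly_def riesz_zero,
      simp add: riesz_def sum_distrib_left mult_ac)

lemma riesz_const: "riesz y (const_poly c) = c * y 0"
  by (simp add: const_poly_def riesz_single)

lemma riesz_quad_form:
  "riesz y (quad_form l P \<xi>) = (\<Sum>a\<in>{1..l}. \<Sum>b\<in>{1..l}. \<xi> a * riesz y (P a b) * \<xi> b)"
proof -
  have "const_poly c * p * const_poly d = const_poly c * (const_poly d * p)" for c d :: real and p :: "'n mpoly"
    by (simp add: mult_ac)
  then show ?thesis
    by (simp add: quad_form_def riesz_sum riesz_const_mult mult_ac)
qed

lemma riesz_tangent:
  assumes "y 0 = 1"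
  shows "riesz y (tangent p (\<chi> j. y (unit_mono j))) = poly_eval p (\<chi> j. y (unit_mono j))"
  using assms
  by (simp add: tangent_def riesz_add riesz_sum riesz_const riesz_const_mult riesz_diff
      mono_poly_def riesz_single)

lemma moment_mat_eq: "moment_mat y \<alpha> \<beta> = y (\<alpha> + \<beta>)"
  by (simp add: moment_mat_def mono_poly_def mult_single riesz_single)

lemma finite_mono_set: "finite (mono_set D d)"
proof -
  have "Poly_Mapping.lookup ` mono_set D d \<subseteq> PiE UNIV (\<lambda>_. {..d})"
  proof (intro image_subsetI)
    fix \<alpha> assume "\<alpha> \<in> mono_set D d"
    then have "(\<Sum>j\<in>UNIV. Poly_Mapping.lookup \<alpha> j) \<le> d"
      by (simp add: mono_set_def mono_deg_def)
    moreover have "Poly_Mapping.lookup \<alpha> j \<le> (\<Sum>j\<in>UNIV. Poly_Mapping.lookup \<alpha> j)" for j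
      by (rule member_le_sum) auto
    ultimately show "Poly_Mapping.lookup \<alpha> \<in> PiE UNIV (\<lambda>_. {..d})"
      by (auto intro: order_trans)
  qed
  then have "finite (Poly_Mapping.lookup ` mono_set D d)"
    by (rule finite_subset) (intro finite_PiE, auto)
  then show ?thesis
    by (rule finite_imageD) (simp add: inj_on_def)
qed

lemma keys_subset_mono_set:
  "q \<in> polys_in D \<Longrightarrow> poly_deg q \<le> k \<Longrightarrow> Poly_Mapping.keys q \<subseteq> mono_set D k"
  using polys_in_lookup_zero by (fastforce simp: mono_set_def poly_deg_le_iff)

lemma riesz_square_nonneg:
  assumes psd: "psd_on (mono_set D k) (moment_mat y)"
    and q: "q \<in> polys_in D" "poly_deg q \<le> k"
  shows "riesz y (q\<^sup>2) \<ge> 0"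
proof -
  let ?K = "Poly_Mapping.keys q" and ?S = "mono_set D k"
  let ?t = "\<lambda>\<alpha> \<beta>. Poly_Mapping.lookup q \<alpha> * moment_mat y \<alpha> \<beta> * Poly_Mapping.lookup q \<beta>"
  have KS: "?K \<subseteq> ?S" using q by (rule keys_subset_mono_set)
  have "riesz y (q\<^sup>2) = (\<Sum>\<alpha>\<in>?K. \<Sum>\<beta>\<in>?K. ?t \<alpha> \<beta>)"
    unfolding power2_eq_square riesz_mult moment_mat_eq by (simp add: mult_ac)
  also have "\<dots> = (\<Sum>\<alpha>\<in>?K. \<Sum>\<beta>\<in>?S. ?t \<alpha> \<beta>)"
    using KS by (intro sum.cong refl sum.mono_neutral_left finite_mono_set) (auto simp: in_keys_iff)
  also have "\<dots> = (\<Sum>\<alpha>\<in>?S. \<Sum>\<beta>\<in>?S. ?t \<alpha> \<beta>)"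
    using KS by (intro sum.mono_neutral_left finite_mono_set) (auto simp: in_keys_iff)
  also have "\<dots> \<ge> 0" using psd unfolding psd_on_def by blast
  finally show ?thesis .
qed

text \<open>
  The moment matrix of order \<open>k\<close> only controls squares of polynomials of degree at most \<open>k\<close>, so the
  degrees of the single squares have to be bounded by that of their sum.
\<close>

lemma riesz_sos_nonneg:
  assumes "psd_on (mono_set D k) (moment_mat y)" "is_sos D p" "poly_deg p \<le> 2 * k"
  shows "riesz y p \<ge> 0"
proof -
  obtain s q where q: "\<forall>j\<in>{1..s::nat}. q j \<in> polys_in D" and p: "p = (\<Sum>j\<in>{1..s}. (q j)\<^sup>2)"
    using assms(2) unfolding is_sos_def by blast
  have "riesz y ((q j)\<^sup>2) \<ge> 0" if "j \<in> {1..s}" for j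
    using assms(1,3) that q unfolding p
    by (intro riesz_square_nonneg) (auto intro: poly_deg_summand_of_squares[of "{1..s}"])
  then show ?thesis unfolding p riesz_sum by (rule sum_nonneg)
qed

text \<open>
  Jensen's inequality for a functional that need not come from a measure. Linearity makes the value of
  the tangent of \<open>p\<close> at the point of first moments equal to the value of \<open>p\<close> there, and the remainder
  is a sum of squares of degree at most \<open>2 * k\<close>, on which the functional is nonnegative.
\<close>

theorem jensen_pseudo_moments:
  assumes "psd_on (mono_set D k) (moment_mat y)" "y 0 = 1"
    and p: "p \<in> polys_in D" "sos_hessian D p" "poly_deg p \<le> 2 * k" and "k \<ge> 1"
  shows "poly_eval p (\<chi> j. y (unit_mono j)) \<le> riesz y p"
proof -
  let ?x = "\<chi> j. y (unit_mono j)"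
  have "poly_deg (p - tangent p ?x) \<le> 2 * k"
    using p(3) \<open>k \<ge> 1\<close> poly_deg_tangent[of p ?x] by (intro poly_deg_diff) auto
  then have "riesz y (p - tangent p ?x) \<ge> 0"
    using assms(1) sos_hessian_remainder[OF p(1,2)] by (intro riesz_sos_nonneg)
  then show ?thesis
    using riesz_tangent[of y p] assms(2) by (simp add: riesz_diff)
qed

section \<open>Lagrange multipliers for cone constraints\<close>

text \<open>
  A linear functional below a sublinear one, extended coordinate by coordinate: sublinearity puts every
  lower bound \<open>L v\<close> for the new coefficient below every upper bound \<open>U w\<close>. Working in coordinates with
  an arbitrary finite index set leaves the dimension free to depend on the sizes of the matrices.
\<close>

lemma finite_dim_hahn_banach:
  fixes p :: "('k \<Rightarrow> real) \<Rightarrow> real"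
  assumes "finite I"
    and "\<And>v w. (\<And>k. k \<notin> I \<Longrightarrow> v k = 0) \<Longrightarrow> (\<And>k. k \<notin> I \<Longrightarrow> w k = 0) \<Longrightarrow>
           p (\<lambda>k. v k + w k) \<le> p v + p w"
    and "\<And>r v. (\<And>k. k \<notin> I \<Longrightarrow> v k = 0) \<Longrightarrow> r > 0 \<Longrightarrow> p (\<lambda>k. r * v k) \<le> r * p v"
  shows "\<exists>c. \<forall>v. (\<forall>k. k \<notin> I \<longrightarrow> v k = 0) \<longrightarrow> (\<Sum>k\<in>I. c k * v k) \<le> p v"
  using assms
proof (induction I rule: finite_induct)
  case empty
  have "p (\<lambda>_. 0) \<le> 2 * p (\<lambda>_. 0)"
    using empty.prems(2)[of "\<lambda>_. 0" 2] by simp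
  then have "0 \<le> p v" if "\<forall>k. v k = 0" for v
    using that by (metis ext le_add_same_cancel1 mult_2)
  then show ?case by simp
next
  case (insert j I)
  note sub = insert.prems(1) and hom = insert.prems(2)
  have "\<exists>c. \<forall>v. (\<forall>k. k \<notin> I \<longrightarrow> v k = 0) \<longrightarrow> (\<Sum>k\<in>I. c k * v k) \<le> p v"
    by (rule insert.IH) (auto intro: sub hom)
  then obtain c where c: "\<And>v. (\<And>k. k \<notin> I \<Longrightarrow> v k = 0) \<Longrightarrow> (\<Sum>k\<in>I. c k * v k) \<le> p v"
    by blast
  define V where "V = {v :: 'k \<Rightarrow> real. \<forall>k. k \<notin> I \<longrightarrow> v k = 0}"
  define C where "C v = (\<Sum>k\<in>I. c k * v k)" for v
  define U where "U w = p (w(j := 1)) - C w" for w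
  define L where "L v = C v - p (v(j := -1))" for v
  have LU: "L v \<le> U w" if "v \<in> V" "w \<in> V" for v w
  proof -
    have "C v + C w = C (\<lambda>k. v k + w k)"
      by (simp add: C_def sum.distrib distrib_left)
    also have "\<dots> \<le> p (\<lambda>k. v k + w k)"
      unfolding C_def using that by (intro c) (simp add: V_def)
    also have "(\<lambda>k. v k + w k) = (\<lambda>k. (v(j := -1)) k + (w(j := 1)) k)"
      using that insert.hyps(2) by (auto simp: V_def fun_eq_iff)
    also have "p \<dots> \<le> p (v(j := -1)) + p (w(j := 1))"
      using that by (intro sub) (auto simp: V_def)
    finally show ?thesis by (simp add: L_def U_def)
  qed
  have "(\<lambda>_. 0) \<in> V" by (simp add: V_def)
  define cj where "cj = (INF w\<in>V. U w)"
  have upper: "cj \<le> U w" if "w \<in> V" for w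
    unfolding cj_def using that LU[OF \<open>(\<lambda>_. 0) \<in> V\<close>]
    by (intro cINF_lower bdd_belowI2) auto
  have lower: "L v \<le> cj" if "v \<in> V" for v
    unfolding cj_def using that \<open>(\<lambda>_. 0) \<in> V\<close> LU by (intro cINF_greatest) auto
  have "(\<Sum>k\<in>insert j I. (c(j := cj)) k * v k) \<le> p v" if v: "\<forall>k. k \<notin> insert j I \<longrightarrow> v k = 0" for v
  proof -
    have split: "(\<Sum>k\<in>insert j I. (c(j := cj)) k * v k) = cj * v j + C v"
    proof -
      have "(\<Sum>k\<in>I. (c(j := cj)) k * v k) = C v"
        unfolding C_def using insert.hyps(2) by (intro sum.cong) auto
      then show ?thesis using insert.hyps by simp
    qed
    have scale: "p (\<lambda>k. r * v k) \<le> r * p v" if "r > 0" for r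
      using that v by (intro hom) auto
    have C_scale: "C (\<lambda>k. if k = j then 0 else r * v k) = r * C v" for r
      unfolding C_def sum_distrib_left using insert.hyps(2) by (intro sum.cong) auto
    have inV: "(\<lambda>k. if k = j then 0 else r * v k) \<in> V" for r
      using v by (auto simp: V_def)
    consider "v j = 0" | "v j > 0" | "v j < 0" by linarith
    then have "cj * v j + C v \<le> p v"
    proof cases
      case 1
      then have "\<And>k. k \<notin> I \<Longrightarrow> v k = 0" using v by auto
      then show ?thesis using c[of v] 1 by (simp add: C_def)
    next
      case 2
      define r where "r = 1 / v j"
      have r: "r > 0" "r * v j = 1" using 2 by (simp_all add: r_def)
      have eq: "(\<lambda>k. if k = j then 0 else r * v k)(j := 1) = (\<lambda>k. r * v k)"
        using r by (auto simp: fun_eq_iff)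
      have "cj \<le> r * p v - r * C v"
        using upper[OF inV[of r]] scale[OF r(1)] unfolding U_def C_scale eq by linarith
      then have "cj * v j \<le> (r * p v - r * C v) * v j"
        using 2 by (intro mult_right_mono) auto
      also have "\<dots> = (r * v j) * (p v - C v)" by (simp add: algebra_simps)
      finally show ?thesis using r by simp
    next
      case 3
      define r where "r = - 1 / v j"
      have r: "r > 0" "r * v j = - 1" using 3 by (simp_all add: r_def)
      have eq: "(\<lambda>k. if k = j then 0 else r * v k)(j := -1) = (\<lambda>k. r * v k)"
        using r by (auto simp: fun_eq_iff)
      have "r * C v - r * p v \<le> cj"
        using lower[OF inV[of r]] scale[OF r(1)] unfolding L_def C_scale eq by linarith
      then have "cj * v j \<le> (r * C v - r * p v) * v j"
        using 3 by (intro mult_right_mono_neg) auto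
      also have "\<dots> = (r * v j) * (C v - p v)" by (simp add: algebra_simps)
      finally show ?thesis using r by simp
    qed
    then show ?thesis using split by simp
  qed
  then show ?case by blast
qed

text \<open>
  Let \<open>\<phi> v\<close> be the infimum of \<open>f x\<close> subject to \<open>g x + v \<in> C\<close>. It is a convex function of the
  perturbation \<open>v\<close>, and \<open>p v\<close> is its directional derivative at \<open>0\<close>, the infimum over \<open>t > 0\<close> of the
  difference quotients \<open>(\<phi> (t v) - \<phi> 0) / t\<close>. Slater's condition makes \<open>p\<close> finite: from the point \<open>e\<close> one
  can move in the direction \<open>v\<close> (so the infimum is over a nonempty set) and in the direction \<open>- v\<close> (and
  mixing such a point with an admissible \<open>x\<close> gives a feasible point, which bounds the quotients below).
  A linear functional below \<open>p\<close> is a subgradient of \<open>\<phi>\<close> at \<open>0\<close>, and its negative is the multiplier.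
\<close>

theorem cone_lagrange_multipliers:
  fixes f :: "'x::real_vector \<Rightarrow> real" and g :: "'x \<Rightarrow> 'k \<Rightarrow> real" and C :: "('k \<Rightarrow> real) set"
  assumes I: "finite I" and supp: "\<And>x k. k \<notin> I \<Longrightarrow> g x k = 0"
    and C_add: "\<And>v w. v \<in> C \<Longrightarrow> w \<in> C \<Longrightarrow> (\<lambda>k. v k + w k) \<in> C"
    and C_scale: "\<And>r v. r \<ge> 0 \<Longrightarrow> v \<in> C \<Longrightarrow> (\<lambda>k. r * v k) \<in> C"
    and f: "convex_on UNIV f"
    and g: "\<And>x z s t. s \<ge> 0 \<Longrightarrow> t \<ge> 0 \<Longrightarrow> s + t = 1 \<Longrightarrow>
              (\<lambda>k. g (s *\<^sub>R x + t *\<^sub>R z) k - s * g x k - t * g z k) \<in> C"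
    and slater: "\<And>v. (\<And>k. k \<notin> I \<Longrightarrow> v k = 0) \<Longrightarrow> \<exists>s>0. (\<lambda>k. g e k + s * v k) \<in> C"
    and u: "g u \<in> C" and opt: "\<And>x. g x \<in> C \<Longrightarrow> f u \<le> f x"
  shows "\<exists>c. (\<forall>v\<in>C. (\<forall>k. k \<notin> I \<longrightarrow> v k = 0) \<longrightarrow> (\<Sum>k\<in>I. c k * v k) \<ge> 0) \<and>
             (\<forall>x. (\<Sum>k\<in>I. c k * g x k) \<le> f x - f u)"
proof -
  define V where "V = {v :: 'k \<Rightarrow> real. \<forall>k. k \<notin> I \<longrightarrow> v k = 0}"
  define S where "S v = {(f x - f u) / t |x t. t > 0 \<and> (\<lambda>k. g x k + t * v k) \<in> C}" for v
  define p where "p v = Inf (S v)" for v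
  have SI: "(f x - f u) / t \<in> S v" if "t > 0" "(\<lambda>k. g x k + t * v k) \<in> C" for x t v
    using that by (auto simp: S_def)
  \<comment> \<open>Convex combinations of admissible points are admissible for the combined perturbation.\<close>
  have mix: "(\<lambda>k. g (s *\<^sub>R x + t *\<^sub>R z) k + r k) \<in> C" "f (s *\<^sub>R x + t *\<^sub>R z) \<le> s * f x + t * f z"
    if "s \<ge> 0" "t \<ge> 0" "s + t = 1" "(\<lambda>k. g x k + v k) \<in> C" "(\<lambda>k. g z k + w k) \<in> C"
      "\<And>k. s * v k + t * w k = r k" for s t x z v w r
  proof -
    have "(\<lambda>k. (g (s *\<^sub>R x + t *\<^sub>R z) k - s * g x k - t * g z k) +
        (s * (g x k + v k) + t * (g z k + w k))) \<in> C"
      by (rule C_add[OF g[OF that(1-3)] C_add[OF C_scale[OF that(1,4)] C_scale[OF that(2,5)]]])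
    also have "(\<lambda>k. (g (s *\<^sub>R x + t *\<^sub>R z) k - s * g x k - t * g z k) +
        (s * (g x k + v k) + t * (g z k + w k))) = (\<lambda>k. g (s *\<^sub>R x + t *\<^sub>R z) k + r k)"
      by (simp add: fun_eq_iff algebra_simps that(6)[symmetric])
    finally show "(\<lambda>k. g (s *\<^sub>R x + t *\<^sub>R z) k + r k) \<in> C" .
    show "f (s *\<^sub>R x + t *\<^sub>R z) \<le> s * f x + t * f z"
      using f that(1-3) by (simp add: convex_on_def)
  qed
  have ne: "S v \<noteq> {}" if v: "v \<in> V" for v
  proof -
    obtain s where "s > 0" "(\<lambda>k. g e k + s * v k) \<in> C"
      using slater[of v] v by (auto simp: V_def)
    then show ?thesis using SI by blast
  qed
  have bdd: "bdd_below (S v)" if v: "v \<in> V" for v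
  proof -
    obtain s where s: "s > 0" "(\<lambda>k. g e k + s * - v k) \<in> C"
      using slater[of "\<lambda>k. - v k"] v by (auto simp: V_def)
    have "- (f e - f u) / s \<le> (f x - f u) / t" if t: "t > 0" "(\<lambda>k. g x k + t * v k) \<in> C" for x t
    proof -
      \<comment> \<open>Weights for which the perturbations \<open>t v\<close> and \<open>- s v\<close> cancel.\<close>
      define \<sigma> where "\<sigma> = s / (s + t)"
      define \<tau> where "\<tau> = t / (s + t)"
      have w: "\<sigma> \<ge> 0" "\<tau> \<ge> 0" "\<sigma> + \<tau> = 1"
        using s(1) t(1) by (simp_all add: \<sigma>_def \<tau>_def add_divide_distrib[symmetric])
      have "\<sigma> * (t * v k) + \<tau> * (s * - v k) = 0" for k
        by (simp add: \<sigma>_def \<tau>_def)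
      from mix[OF w t(2) s(2) this]
      have "f u \<le> \<sigma> * f x + \<tau> * f e"
        using opt[of "\<sigma> *\<^sub>R x + \<tau> *\<^sub>R e"] by simp
      moreover have "f u = \<sigma> * f u + \<tau> * f u"
        using w(3) by (simp flip: distrib_right)
      ultimately have "0 \<le> \<sigma> * (f x - f u) + \<tau> * (f e - f u)"
        by (simp add: algebra_simps)
      also have "\<dots> = (s * (f x - f u) + t * (f e - f u)) / (s + t)"
        by (simp add: \<sigma>_def \<tau>_def add_divide_distrib)
      finally have "0 \<le> s * (f x - f u) + t * (f e - f u)"
        using s(1) t(1) by (simp add: zero_le_divide_iff)
      then show ?thesis using s(1) t(1) by (simp add: field_simps)
    qed
    then show ?thesis by (intro bdd_belowI[of _ "- (f e - f u) / s"]) (auto simp: S_def)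
  qed
  have p_le: "p v \<le> a" if "v \<in> V" "a \<in> S v" for v a
    unfolding p_def using that bdd by (intro cInf_lower)
  have p_add: "p (\<lambda>k. v k + w k) \<le> p v + p w" if v: "v \<in> V" and w: "w \<in> V" for v w
  proof -
    have vw: "(\<lambda>k. v k + w k) \<in> V" using v w by (simp add: V_def)
    have "p (\<lambda>k. v k + w k) \<le> a + b" if ab: "a \<in> S v" "b \<in> S w" for a b
    proof -
      obtain x t where x: "t > 0" "(\<lambda>k. g x k + t * v k) \<in> C" "a = (f x - f u) / t"
        using ab(1) by (auto simp: S_def)
      obtain z s where z: "s > 0" "(\<lambda>k. g z k + s * w k) \<in> C" "b = (f z - f u) / s"
        using ab(2) by (auto simp: S_def)
      \<comment> \<open>Weights for which both perturbations are scaled by the same \<open>r\<close>, with \<open>1 / r = 1 / s + 1 / t\<close>.\<close>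
      define \<sigma> where "\<sigma> = s / (s + t)"
      define \<tau> where "\<tau> = t / (s + t)"
      define r where "r = s * t / (s + t)"
      have st: "\<sigma> \<ge> 0" "\<tau> \<ge> 0" "\<sigma> + \<tau> = 1"
        using z(1) x(1) by (simp_all add: \<sigma>_def \<tau>_def add_divide_distrib[symmetric])
      have r: "r > 0" using x(1) z(1) by (simp add: r_def)
      have "\<sigma> * (t * v k) + \<tau> * (s * w k) = r * (v k + w k)" for k
        by (simp add: \<sigma>_def \<tau>_def r_def algebra_simps add_divide_distrib)
      note m = mix[OF st x(2) z(2) this]
      have "p (\<lambda>k. v k + w k) \<le> (f (\<sigma> *\<^sub>R x + \<tau> *\<^sub>R z) - f u) / r"
        using p_le[OF vw SI[OF r m(1)]] .
      also have "\<dots> \<le> (\<sigma> * f x + \<tau> * f z - (\<sigma> + \<tau>) * f u) / r"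
        using m(2) r st(3) by (intro divide_right_mono) auto
      also have "\<dots> = (\<sigma> / r) * (f x - f u) + (\<tau> / r) * (f z - f u)"
        by (simp add: diff_divide_distrib add_divide_distrib algebra_simps)
      also have "\<sigma> / r = 1 / t" using x(1) z(1) by (simp add: \<sigma>_def r_def)
      also have "\<tau> / r = 1 / s" using x(1) z(1) by (simp add: \<tau>_def r_def)
      finally show ?thesis using x(3) z(3) by simp
    qed
    then have "p (\<lambda>k. v k + w k) - b \<le> p v" if "b \<in> S w" for b
      unfolding p_def[of v] using that ne[OF v] by (intro cInf_greatest) (auto simp: algebra_simps)
    then have "p (\<lambda>k. v k + w k) - p v \<le> p w"
      unfolding p_def[of w] using ne[OF w] by (intro cInf_greatest) (auto simp: algebra_simps)
    then show ?thesis by simp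
  qed
  have p_hom: "p (\<lambda>k. r * v k) \<le> r * p v" if v: "v \<in> V" and r: "r > 0" for r v
  proof -
    have rv: "(\<lambda>k. r * v k) \<in> V" using v by (simp add: V_def)
    have "p (\<lambda>k. r * v k) / r \<le> a" if "a \<in> S v" for a
    proof -
      obtain x t where x: "t > 0" "(\<lambda>k. g x k + t * v k) \<in> C" "a = (f x - f u) / t"
        using \<open>a \<in> S v\<close> by (auto simp: S_def)
      have "(\<lambda>k. g x k + (t / r) * (r * v k)) \<in> C" using x(2) r by simp
      then have "p (\<lambda>k. r * v k) \<le> (f x - f u) / (t / r)"
        using x(1) r by (intro p_le[OF rv] SI) auto
      then have "p (\<lambda>k. r * v k) \<le> a * r" by (simp add: x(3))
      then show ?thesis using r by (simp add: pos_divide_le_eq)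
    qed
    then have "p (\<lambda>k. r * v k) / r \<le> p v"
      unfolding p_def[of v] using ne[OF v] by (intro cInf_greatest)
    then show ?thesis using r by (simp add: field_simps)
  qed
  obtain c where c: "\<And>v. v \<in> V \<Longrightarrow> (\<Sum>k\<in>I. c k * v k) \<le> p v"
    using finite_dim_hahn_banach[OF I, of p] p_add p_hom unfolding V_def by auto
  have "(\<Sum>k\<in>I. - c k * v k) \<ge> 0" if v: "v \<in> C" "v \<in> V" for v
  proof -
    have "(\<lambda>k. g u k + 1 * v k) \<in> C" using C_add[OF u v(1)] by simp
    from p_le[OF v(2) SI[OF _ this]] have "p v \<le> 0" by simp
    then show ?thesis using c[OF v(2)] by (simp add: sum_negf)
  qed
  moreover have "(\<Sum>k\<in>I. - c k * g x k) \<le> f x - f u" for x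
  proof -
    have "(\<lambda>k. - g x k) \<in> V" using supp by (simp add: V_def)
    moreover have "(\<lambda>k. g x k + 1 * - g x k) \<in> C"
      using C_scale[of 0, OF _ u] by simp
    ultimately have "p (\<lambda>k. - g x k) \<le> f x - f u"
      using p_le[OF _ SI[of 1 x]] by simp
    then show ?thesis using c[OF \<open>(\<lambda>k. - g x k) \<in> V\<close>] by simp
  qed
  ultimately show ?thesis
    by (intro exI[of _ "\<lambda>k. - c k"]) (simp add: V_def)
qed

section \<open>Tangents at minimizers\<close>

lemma poly_eval_tangent_add:
  "poly_eval (tangent (p + q) a) x = poly_eval (tangent p a) x + poly_eval (tangent q a) x"
  by (simp add: poly_eval_tangent poly_eval_partial riesz_add distrib_right sum.distrib)

lemma poly_eval_tangent_zero: "poly_eval (tangent 0 a) x = 0"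
  by (simp add: poly_eval_tangent poly_eval_partial riesz_zero)

lemma poly_eval_tangent_sum:
  "poly_eval (tangent (\<Sum>i\<in>I. p i) a) x = (\<Sum>i\<in>I. poly_eval (tangent (p i) a) x)"
  by (induction I rule: infinite_finite_induct)
     (simp_all add: poly_eval_tangent_zero poly_eval_tangent_add)

lemma tangent_at_minimum:
  assumes min: "\<And>x. poly_eval p a \<le> poly_eval p x"
  shows "poly_eval (tangent p a) x = poly_eval p a"
proof -
  have "poly_eval (partial j p) a = 0" for j
  proof (rule DERIV_local_min)
    have "(\<Sum>i\<in>UNIV. axis j 1 $ i * poly_eval (partial i p) (a + 0 *\<^sub>R axis j 1)) =
        (\<Sum>i\<in>UNIV. if i = j then poly_eval (partial i p) a else 0)"
      by (intro sum.cong) (auto simp: axis_def)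
    then have "(\<Sum>i\<in>UNIV. axis j 1 $ i * poly_eval (partial i p) (a + 0 *\<^sub>R axis j 1)) =
        poly_eval (partial j p) a"
      by simp
    then show "((\<lambda>t. poly_eval p (a + t *\<^sub>R axis j 1)) has_real_derivative poly_eval (partial j p) a) (at 0)"
      using poly_eval_has_derivative_on_line[of p a "axis j 1" 0] by metis
    show "\<forall>t. \<bar>0 - t\<bar> < 1 \<longrightarrow> poly_eval p (a + 0 *\<^sub>R axis j 1) \<le> poly_eval p (a + t *\<^sub>R axis j 1)"
      using min by simp
  qed simp
  then show ?thesis by (simp add: poly_eval_tangent)
qed

section \<open>The sparse SOS-convex program and its relaxations\<close>

locale sparse_sos_convex_program =
  fixes m :: nat
    and \<Delta> :: "nat \<Rightarrow> 'n::finite set"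
    and l :: "nat \<Rightarrow> nat"
    and f :: "nat \<Rightarrow> 'n mpoly"
    and G :: "nat \<Rightarrow> nat \<Rightarrow> nat \<Rightarrow> 'n mpoly"
    and u :: "real ^ 'n"
  assumes cover: "(\<Union>i\<in>{1..m}. \<Delta> i) = UNIV"
    and size_pos: "\<And>i. i \<in> {1..m} \<Longrightarrow> l i \<ge> 1"
    and f_vars: "\<And>i. i \<in> {1..m} \<Longrightarrow> f i \<in> polys_in (\<Delta> i)"
    and G_vars: "\<And>i a b. i \<in> {1..m} \<Longrightarrow> a \<in> {1..l i} \<Longrightarrow> b \<in> {1..l i} \<Longrightarrow>
                   G i a b \<in> polys_in (\<Delta> i)"
    and G_sym: "\<And>i a b. i \<in> {1..m} \<Longrightarrow> a \<in> {1..l i} \<Longrightarrow> b \<in> {1..l i} \<Longrightarrow>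
                   G i a b = G i b a"
    and minimizer: "is_minimizer m l f G u"
    and f_convex: "\<And>i. i \<in> {1..m} \<Longrightarrow> sos_convex (\<Delta> i) (f i)"
    and G_concave: "\<And>i. i \<in> {1..m} \<Longrightarrow> sos_concave_mat (\<Delta> i) (l i) (G i)"
begin

abbreviation F :: "real ^ 'n \<Rightarrow> real" where "F \<equiv> poly_eval (objective m f)"

abbreviation form :: "nat \<Rightarrow> (nat \<Rightarrow> real) \<Rightarrow> 'n mpoly" where
  "form i \<xi> \<equiv> quad_form (l i) (G i) \<xi>"

lemma feasible_iff:
  "x \<in> feasible_set m l G \<longleftrightarrow> (\<forall>i\<in>{1..m}. \<forall>\<xi>. poly_eval (form i \<xi>) x \<ge> 0)"
  unfolding feasible_set_def psd_on_def poly_eval_quad_form using G_sym by simp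

lemma u_feasible: "u \<in> feasible_set m l G"
  and opt_value_eq: "opt_value m l f G = ereal (F u)"
  using minimizer by (simp_all add: is_minimizer_def)

lemma u_optimal: "x \<in> feasible_set m l G \<Longrightarrow> F u \<le> F x"
  using INF_lower[of x "feasible_set m l G" "\<lambda>x. ereal (F x)"] opt_value_eq
  by (simp add: opt_value_def)

lemma is_minimizer_iff: "is_minimizer m l f G x \<longleftrightarrow> x \<in> feasible_set m l G \<and> F x \<le> F u"
  using u_optimal[of x] by (auto simp: is_minimizer_def opt_value_eq)

lemma form_vars: "i \<in> {1..m} \<Longrightarrow> form i \<xi> \<in> polys_in (\<Delta> i)"
  by (intro polys_in_quad_form G_vars)

lemma neg_form_vars: "i \<in> {1..m} \<Longrightarrow> - form i \<xi> \<in> polys_in (\<Delta> i)"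
  by (intro polys_in_uminus form_vars)

lemma f_hessian: "i \<in> {1..m} \<Longrightarrow> sos_hessian (\<Delta> i) (f i)"
  by (intro sos_convex_imp_sos_hessian f_convex)

lemma neg_form_hessian: "i \<in> {1..m} \<Longrightarrow> sos_hessian (\<Delta> i) (- form i \<xi>)"
  by (intro sos_concave_imp_sos_hessian G_concave)

lemma order_ge_imp:
  assumes "min_order m l f G \<le> k" "i \<in> {1..m}"
  shows f_deg: "poly_deg (f i) \<le> 2 * k" and G_deg: "mat_deg (l i) (G i) \<le> 2 * k"
proof -
  have "max (nat \<lceil>real (poly_deg (f i)) / 2\<rceil>) (nat \<lceil>real (mat_deg (l i) (G i)) / 2\<rceil>) \<le> min_order m l f G"
    unfolding min_order_def using assms(2) by (intro Max_ge) auto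
  then have "nat \<lceil>real (poly_deg (f i)) / 2\<rceil> \<le> k" "nat \<lceil>real (mat_deg (l i) (G i)) / 2\<rceil> \<le> k"
    using assms(1) by auto
  then show "poly_deg (f i) \<le> 2 * k" "mat_deg (l i) (G i) \<le> 2 * k"
    by (simp_all add: nat_le_iff ceiling_le_iff)
qed

lemma entry_deg: "a \<in> {1..l i} \<Longrightarrow> b \<in> {1..l i} \<Longrightarrow> poly_deg (G i a b) \<le> mat_deg (l i) (G i)"
  unfolding mat_deg_def by (intro Max_ge) auto

lemma form_deg:
  assumes "min_order m l f G \<le> k" "i \<in> {1..m}"
  shows "poly_deg (form i \<xi>) \<le> 2 * k"
  using G_deg[OF assms] entry_deg by (intro poly_deg_quad_form) (metis order_trans)

subsection \<open>Moment relaxation\<close>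

text \<open>
  The constant monomial indexes a block of the localizing matrix, so the pseudo-expectation of every
  \<open>\<xi>\<^sup>T G \<xi>\<close> is nonnegative. By Jensen's inequality for the SOS-concave \<open>\<xi>\<^sup>T G \<xi>\<close> its value at the point of
  first moments is at least as large, which makes that point feasible; for the SOS-convex objective the
  inequality goes the other way. The blocks \<open>\<Delta> i\<close> share the moments of their common variables, so a
  single \<open>x\<close> serves all of them.
\<close>

lemma moment_feasible_lower_bound:
  assumes k: "1 \<le> k" "min_order m l f G \<le> k" and y: "y \<in> moment_feasible m \<Delta> l G k"
  defines "x \<equiv> \<chi> j. y (unit_mono j)"
  shows "x \<in> feasible_set m l G" and "F x \<le> moment_objective m f y"
proof -
  have y0: "y 0 = 1" using y by (simp add: moment_feasible_def)
  have moment: "psd_on (mono_set (\<Delta> i) k) (moment_mat y)"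
    and loc: "psd_on ({1..l i} \<times> mono_set (\<Delta> i) (localizing_order (l i) (G i) k)) (localizing_mat (G i) y)"
    if "i \<in> {1..m}" for i
    using y that by (auto simp: moment_feasible_def)
  have "poly_eval (form i \<xi>) x \<ge> 0" if i: "i \<in> {1..m}" for i \<xi>
  proof -
    let ?S = "mono_set (\<Delta> i) (localizing_order (l i) (G i) k)"
    \<comment> \<open>Supported on the block of the constant monomial, whose entries are the \<open>riesz y (G i a b)\<close>.\<close>
    define v where "v = (\<lambda>(a, \<alpha>). if \<alpha> = (0 :: 'n mono) then \<xi> a else 0)"
    have zero: "0 \<in> ?S" by (simp add: mono_set_def mono_deg_def)
    have v: "v p = 0" if "p \<in> {1..l i} \<times> ?S - {1..l i} \<times> {0}" for p
      using that by (auto simp: v_def split: if_splits)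
    have sub: "{1..l i} \<times> {0} \<subseteq> {1..l i} \<times> ?S" "finite ({1..l i} \<times> ?S)"
      using zero by (auto intro: finite_mono_set)
    have restrict: "(\<Sum>p\<in>{1..l i} \<times> ?S. h p) = (\<Sum>p\<in>{1..l i} \<times> {0}. h p)"
      if "\<And>p. v p = 0 \<Longrightarrow> h p = 0" for h :: "nat \<times> 'n mono \<Rightarrow> real"
      by (rule sum.mono_neutral_right[OF sub(2,1)]) (use v that in blast)
    have "(\<Sum>p\<in>{1..l i} \<times> ?S. \<Sum>q\<in>{1..l i} \<times> ?S. v p * localizing_mat (G i) y p q * v q) =
        (\<Sum>p\<in>{1..l i} \<times> {0}. \<Sum>q\<in>{1..l i} \<times> {0}. v p * localizing_mat (G i) y p q * v q)"
      by (subst restrict, simp, intro sum.cong refl restrict) simp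
    also have "\<dots> = (\<Sum>a\<in>{1..l i}. \<Sum>b\<in>{1..l i}. \<xi> a * riesz y (G i a b) * \<xi> b)"
      by (simp add: sum.cartesian_product' v_def localizing_mat_def mono_poly_def)
    also have "\<dots> = riesz y (form i \<xi>)"
      by (rule riesz_quad_form[symmetric])
    finally have "riesz y (form i \<xi>) \<ge> 0"
      using loc[OF i, unfolded psd_on_def, THEN conjunct2, rule_format, of v] by simp
    moreover have "poly_eval (- form i \<xi>) x \<le> riesz y (- form i \<xi>)"
      unfolding x_def using form_deg[OF k(2) i]
      by (intro jensen_pseudo_moments[OF moment[OF i] y0 neg_form_vars[OF i] neg_form_hessian[OF i] _ k(1)])
        simp
    ultimately show ?thesis by (simp add: riesz_uminus)
  qed
  then show "x \<in> feasible_set m l G" by (simp add: feasible_iff)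
  have "poly_eval (f i) x \<le> riesz y (f i)" if i: "i \<in> {1..m}" for i
    unfolding x_def
    by (rule jensen_pseudo_moments[OF moment[OF i] y0 f_vars[OF i] f_hessian[OF i] f_deg[OF k(2) i] k(1)])
  then show "F x \<le> moment_objective m f y"
    by (auto simp: objective_def moment_objective_def intro!: sum_mono)
qed

text \<open>
  The localizing order keeps all entries within degree \<open>2 * k\<close>, where \<open>y\<close> reproduces evaluation at
  \<open>x\<close>. The form of the moment matrix is then a square, and that of a localizing matrix is a value of the
  form of \<open>G i\<close> at \<open>x\<close>.
\<close>

lemma point_evaluation_feasible:
  assumes k: "min_order m l f G \<le> k" and x: "x \<in> feasible_set m l G"
  defines "y \<equiv> restrict (\<lambda>\<alpha>. mono_eval \<alpha> x) (moment_index m \<Delta> k)"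
  shows "y \<in> moment_feasible m \<Delta> l G k" and "moment_objective m f y = F x"
proof -
  have y_eq: "riesz y p = poly_eval p x"
    if "i \<in> {1..m}" "p \<in> polys_in (\<Delta> i)" "poly_deg p \<le> 2 * k" for i p
    unfolding poly_eval_riesz riesz_def
  proof (rule sum.cong)
    fix \<alpha> assume "\<alpha> \<in> Poly_Mapping.keys p"
    then have "\<alpha> \<in> moment_index m \<Delta> k"
      using keys_subset_mono_set[OF that(2,3)] that(1) by (auto simp: moment_index_def)
    then show "Poly_Mapping.lookup p \<alpha> * y \<alpha> = Poly_Mapping.lookup p \<alpha> * mono_eval \<alpha> x"
      by (simp add: y_def)
  qed simp
  have mono: "mono_poly \<alpha> \<in> polys_in (\<Delta> i)" "poly_deg (mono_poly \<alpha>) \<le> d"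
    if "\<alpha> \<in> mono_set (\<Delta> i) d" for \<alpha> i d
    using that poly_deg_mono[of \<alpha>]
    by (auto simp: mono_set_def in_keys_iff intro!: polys_in_mono)
  have "1 \<le> m" using cover by (cases m) auto
  then have y0: "y 0 = 1"
    by (auto simp: y_def moment_index_def mono_set_def mono_deg_def intro!: bexI[of _ 1])
  have "psd_on ({1..l i} \<times> mono_set (\<Delta> i) (localizing_order (l i) (G i) k)) (localizing_mat (G i) y)"
    if i: "i \<in> {1..m}" for i
  proof -
    let ?d = "localizing_order (l i) (G i) k"
    let ?S = "mono_set (\<Delta> i) ?d"
    have d: "mat_deg (l i) (G i) + (?d + ?d) \<le> 2 * k"
      using G_deg[OF k i] unfolding localizing_order_def by linarith
    have entry: "localizing_mat (G i) y (a, \<alpha>) (b, \<beta>) =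
        poly_eval (G i a b) x * (mono_eval \<alpha> x * mono_eval \<beta> x)"
      if "a \<in> {1..l i}" "b \<in> {1..l i}" "\<alpha> \<in> ?S" "\<beta> \<in> ?S" for a b \<alpha> \<beta>
    proof -
      have "poly_deg (G i a b * (mono_poly \<alpha> * mono_poly \<beta>)) \<le> mat_deg (l i) (G i) + (?d + ?d)"
        using that by (intro poly_deg_mult entry_deg mono(2))
      then have "riesz y (G i a b * (mono_poly \<alpha> * mono_poly \<beta>)) =
          poly_eval (G i a b * (mono_poly \<alpha> * mono_poly \<beta>)) x"
        using that i d
        by (intro y_eq[OF i] polys_in_mult G_vars mono(1)) auto
      then show ?thesis by (simp add: localizing_mat_def)
    qed
    show ?thesis
      unfolding psd_on_def
    proof (intro conjI ballI allI)
      fix p q assume "p \<in> {1..l i} \<times> ?S" "q \<in> {1..l i} \<times> ?S"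
      then show "localizing_mat (G i) y p q = localizing_mat (G i) y q p"
        using G_sym[OF i] by (cases p; cases q) (auto simp: entry)
    next
      fix v :: "nat \<times> 'n mono \<Rightarrow> real"
      define \<xi> where "\<xi> a = (\<Sum>\<alpha>\<in>?S. v (a, \<alpha>) * mono_eval \<alpha> x)" for a
      have "(\<Sum>p\<in>{1..l i} \<times> ?S. \<Sum>q\<in>{1..l i} \<times> ?S. v p * localizing_mat (G i) y p q * v q) =
          (\<Sum>a\<in>{1..l i}. \<Sum>\<alpha>\<in>?S. \<Sum>b\<in>{1..l i}. \<Sum>\<beta>\<in>?S.
             v (a, \<alpha>) * (poly_eval (G i a b) x * (mono_eval \<alpha> x * mono_eval \<beta> x)) * v (b, \<beta>))"
        unfolding sum.cartesian_product' by (intro sum.cong refl) (simp add: entry)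
      also have "\<dots> = (\<Sum>a\<in>{1..l i}. \<Sum>b\<in>{1..l i}. \<Sum>\<alpha>\<in>?S. \<Sum>\<beta>\<in>?S.
             v (a, \<alpha>) * (poly_eval (G i a b) x * (mono_eval \<alpha> x * mono_eval \<beta> x)) * v (b, \<beta>))"
        by (intro sum.cong refl sum.swap)
      also have "\<dots> = (\<Sum>a\<in>{1..l i}. \<Sum>b\<in>{1..l i}. poly_eval (G i a b) x * (\<xi> a * \<xi> b))"
        unfolding \<xi>_def sum_product unfolding sum_distrib_left by (intro sum.cong refl) (simp add: mult_ac)
      also have "\<dots> = poly_eval (form i \<xi>) x"
        unfolding poly_eval_quad_form by (intro sum.cong refl) (simp add: mult_ac)
      finally show "0 \<le> (\<Sum>p\<in>{1..l i} \<times> ?S. \<Sum>q\<in>{1..l i} \<times> ?S. v p * localizing_mat (G i) y p q * v q)"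
        using x i by (simp add: feasible_iff)
    qed
  qed
  moreover have "psd_on (mono_set (\<Delta> i) k) (moment_mat y)" if i: "i \<in> {1..m}" for i
  proof -
    have entry: "moment_mat y \<alpha> \<beta> = mono_eval \<alpha> x * mono_eval \<beta> x"
      if "\<alpha> \<in> mono_set (\<Delta> i) k" "\<beta> \<in> mono_set (\<Delta> i) k" for \<alpha> \<beta>
    proof -
      have "poly_deg (mono_poly \<alpha> * mono_poly \<beta>) \<le> 2 * k"
        using poly_deg_mult[OF mono(2)[OF that(1)] mono(2)[OF that(2)]] by simp
      then show ?thesis
        unfolding moment_mat_def using that
        by (subst y_eq[OF i]) (auto intro!: polys_in_mult mono(1))
    qed
    have "(\<Sum>\<alpha>\<in>mono_set (\<Delta> i) k. \<Sum>\<beta>\<in>mono_set (\<Delta> i) k. v \<alpha> * moment_mat y \<alpha> \<beta> * v \<beta>) =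
        (\<Sum>\<alpha>\<in>mono_set (\<Delta> i) k. v \<alpha> * mono_eval \<alpha> x)\<^sup>2" for v
      unfolding power2_eq_square sum_product
      by (intro sum.cong refl) (simp add: entry mult_ac)
    then show ?thesis
      unfolding psd_on_def by (simp add: entry mult.commute)
  qed
  ultimately show "y \<in> moment_feasible m \<Delta> l G k"
    using y0 by (simp add: moment_feasible_def y_def)
  show "moment_objective m f y = F x"
    by (simp add: moment_objective_def objective_def y_eq f_vars f_deg[OF k])
qed

lemma smo_value_eq:
  assumes k: "1 \<le> k" "min_order m l f G \<le> k"
  shows "smo_value m \<Delta> l f G k = ereal (F u)"
proof (rule antisym)
  show "smo_value m \<Delta> l f G k \<le> ereal (F u)"
    using INF_lower[OF point_evaluation_feasible(1)[OF k(2) u_feasible],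
        of "\<lambda>y. ereal (moment_objective m f y)"]
    by (simp add: smo_value_def point_evaluation_feasible(2)[OF k(2) u_feasible])
  show "ereal (F u) \<le> smo_value m \<Delta> l f G k"
    unfolding smo_value_def
  proof (rule INF_greatest)
    fix y assume y: "y \<in> moment_feasible m \<Delta> l G k"
    show "ereal (F u) \<le> ereal (moment_objective m f y)"
      using u_optimal[OF moment_feasible_lower_bound(1)[OF k y]]
        moment_feasible_lower_bound(2)[OF k y] by simp
  qed
qed

lemma moment_minimizer_imp_minimizer:
  assumes k: "1 \<le> k" "min_order m l f G \<le> k" and y: "is_moment_minimizer m \<Delta> l f G k y"
  shows "is_minimizer m l f G (\<chi> j. y (unit_mono j))"
proof -
  have y': "y \<in> moment_feasible m \<Delta> l G k" "moment_objective m f y = F u"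
    using y smo_value_eq[OF k] by (simp_all add: is_moment_minimizer_def)
  show ?thesis
    using moment_feasible_lower_bound[OF k y'(1)] y'(2) by (simp add: is_minimizer_iff)
qed

subsection \<open>Sums of squares relaxation\<close>

lemma objective_convex: "convex_on UNIV F"
proof -
  have "convex_on UNIV (\<lambda>x. \<Sum>i\<in>{1..m}. poly_eval (f i) x)"
    using sos_hessian_imp_convex_on[OF f_vars f_hessian]
    by (auto simp: convex_on_def sum_distrib_left simp flip: sum.distrib intro!: sum_mono)
  also have "(\<lambda>x. \<Sum>i\<in>{1..m}. poly_eval (f i) x) = F"
    by (simp add: objective_def fun_eq_iff)
  finally show ?thesis .
qed

lemma form_concave:
  assumes "i \<in> {1..m}" "s \<ge> 0" "t \<ge> 0" "s + t = 1"
  shows "s * poly_eval (form i \<xi>) x + t * poly_eval (form i \<xi>) z \<le> poly_eval (form i \<xi>) (s *\<^sub>R x + t *\<^sub>R z)"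
proof -
  have "poly_eval (- form i \<xi>) (s *\<^sub>R x + t *\<^sub>R z) \<le>
      s * poly_eval (- form i \<xi>) x + t * poly_eval (- form i \<xi>) z"
    using sos_hessian_imp_convex_on[OF neg_form_vars neg_form_hessian] assms
    by (simp add: convex_on_def del: poly_eval_uminus)
  then show ?thesis by simp
qed

text \<open>
  All constraints together form one point of the space with coordinates \<open>(i, a, b)\<close>, constrained to the
  cone \<open>C\<close> of families of matrices with nonnegative quadratic forms. Members of \<open>C\<close> need not be
  symmetric; this is what forces symmetry of the multipliers, while testing them with the matrices
  \<open>\<xi> \<xi>\<^sup>T\<close> shows that they are semidefinite.
\<close>

lemma matrix_multipliers:
  assumes "slater m l G"
  shows "\<exists>\<Lambda>. (\<forall>i\<in>{1..m}. psd_on {1..l i} (\<Lambda> i)) \<and>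
    (\<forall>x. (\<Sum>i\<in>{1..m}. \<Sum>a\<in>{1..l i}. \<Sum>b\<in>{1..l i}. \<Lambda> i a b * poly_eval (G i a b) x) \<le> F x - F u)"
proof -
  define I where "I = (SIGMA i:{1..m}. {1..l i} \<times> {1..l i})"
  have "finite I" by (simp add: I_def)
  have mem_I: "(i, a, b) \<in> I \<longleftrightarrow> i \<in> {1..m} \<and> a \<in> {1..l i} \<and> b \<in> {1..l i}" for i a b
    by (auto simp: I_def)
  have sum_I: "(\<Sum>k\<in>I. h k) = (\<Sum>i\<in>{1..m}. \<Sum>a\<in>{1..l i}. \<Sum>b\<in>{1..l i}. h (i, a, b))" for h :: "_ \<Rightarrow> real"
  proof -
    have "(\<Sum>k\<in>I. h k) = (\<Sum>i\<in>{1..m}. \<Sum>p\<in>{1..l i} \<times> {1..l i}. h (i, p))"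
      unfolding I_def by (subst sum.Sigma) (auto intro!: sum.cong)
    then show ?thesis by (simp add: sum.cartesian_product')
  qed
  define qf where "qf v i \<xi> = (\<Sum>a\<in>{1..l i}. \<Sum>b\<in>{1..l i}. \<xi> a * v (i, a, b) * \<xi> b)"
    for v :: "nat \<times> nat \<times> nat \<Rightarrow> real" and i and \<xi> :: "nat \<Rightarrow> real"
  define C where "C = {v. \<forall>i\<in>{1..m}. \<forall>\<xi>. qf v i \<xi> \<ge> 0}"
  define g where "g x = (\<lambda>(i, a, b). if (i, a, b) \<in> I then poly_eval (G i a b) x else 0)" for x
  have qf_g: "qf (g x) i \<xi> = poly_eval (form i \<xi>) x" if "i \<in> {1..m}" for x i \<xi>
    unfolding qf_def poly_eval_quad_form using that
    by (intro sum.cong refl) (simp add: g_def mem_I)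
  have qf_add: "qf (\<lambda>k. v k + w k) i \<xi> = qf v i \<xi> + qf w i \<xi>"
    and qf_diff: "qf (\<lambda>k. v k - w k) i \<xi> = qf v i \<xi> - qf w i \<xi>"
    and qf_scale: "qf (\<lambda>k. r * v k) i \<xi> = r * qf v i \<xi>" for v w r i \<xi>
    by (simp_all add: qf_def algebra_simps sum.distrib sum_subtractf sum_distrib_left)
  have g_C: "g x \<in> C \<longleftrightarrow> x \<in> feasible_set m l G" for x
    by (simp add: C_def qf_g feasible_iff)
  obtain e where e: "\<And>i. i \<in> {1..m} \<Longrightarrow> pd_on {1..l i} (\<lambda>a b. poly_eval (G i a b) e)"
    using assms unfolding slater_def by blast
  \<comment> \<open>A common step length for the finitely many constraints.\<close>
  have absorb: "\<exists>s>0. (\<lambda>k. g e k + s * v k) \<in> C" for v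
  proof -
    have "\<exists>s. \<forall>i\<in>{1..m}. s i > 0 \<and> (\<forall>t \<xi>. 0 \<le> t \<and> t \<le> s i \<longrightarrow>
        0 \<le> (\<Sum>a\<in>{1..l i}. \<Sum>b\<in>{1..l i}. \<xi> a * (poly_eval (G i a b) e + t * v (i, a, b)) * \<xi> b))"
      by (rule bchoice) (use pd_on_perturbation[OF _ e] in auto)
    then obtain s where s: "\<And>i. i \<in> {1..m} \<Longrightarrow> s i > 0"
      "\<And>i t \<xi>. i \<in> {1..m} \<Longrightarrow> 0 \<le> t \<Longrightarrow> t \<le> s i \<Longrightarrow>
        0 \<le> (\<Sum>a\<in>{1..l i}. \<Sum>b\<in>{1..l i}. \<xi> a * (poly_eval (G i a b) e + t * v (i, a, b)) * \<xi> b)"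
      by blast
    define t where "t = Min (insert 1 (s ` {1..m}))"
    have t: "t > 0" using s(1) by (simp add: t_def Min_gr_iff)
    have t_le: "t \<le> s i" if "i \<in> {1..m}" for i
      unfolding t_def using that by (intro Min_le) auto
    have "0 \<le> qf (\<lambda>k. g e k + t * v k) i \<xi>" if i: "i \<in> {1..m}" for i \<xi>
    proof -
      have "qf (\<lambda>k. g e k + t * v k) i \<xi> =
          (\<Sum>a\<in>{1..l i}. \<Sum>b\<in>{1..l i}. \<xi> a * (poly_eval (G i a b) e + t * v (i, a, b)) * \<xi> b)"
        unfolding qf_def using i by (intro sum.cong refl) (simp add: g_def mem_I)
      then show ?thesis using s(2)[OF i] t t_le[OF i] by simp
    qed
    then show ?thesis using t by (intro exI[of _ t]) (simp add: C_def)
  qed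
  have "\<exists>c. (\<forall>v\<in>C. (\<forall>k. k \<notin> I \<longrightarrow> v k = 0) \<longrightarrow> (\<Sum>k\<in>I. c k * v k) \<ge> 0) \<and>
             (\<forall>x. (\<Sum>k\<in>I. c k * g x k) \<le> F x - F u)"
  proof (rule cone_lagrange_multipliers[OF \<open>finite I\<close>])
    show "g x k = 0" if "k \<notin> I" for x k
      using that by (cases k) (simp add: g_def)
    show "(\<lambda>k. v k + w k) \<in> C" if "v \<in> C" "w \<in> C" for v w
      using that by (simp add: C_def qf_add)
    show "(\<lambda>k. r * v k) \<in> C" if "r \<ge> 0" "v \<in> C" for r v
      using that by (simp add: C_def qf_scale)
    show "(\<lambda>k. g (s *\<^sub>R x + t *\<^sub>R z) k - s * g x k - t * g z k) \<in> C"
      if st: "s \<ge> 0" "t \<ge> 0" "s + t = 1" for x z s t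
    proof -
      have "0 \<le> qf (\<lambda>k. g (s *\<^sub>R x + t *\<^sub>R z) k - s * g x k - t * g z k) i \<xi>"
        if i: "i \<in> {1..m}" for i \<xi>
        using form_concave[OF i st, of \<xi> x z] unfolding qf_diff qf_scale qf_g[OF i] by linarith
      then show ?thesis by (simp add: C_def)
    qed
    show "g u \<in> C" using u_feasible by (simp add: g_C)
    show "F u \<le> F x" if "g x \<in> C" for x using that u_optimal by (simp add: g_C)
  qed (use objective_convex absorb in auto)
  then obtain c where c: "\<And>v. v \<in> C \<Longrightarrow> (\<And>k. k \<notin> I \<Longrightarrow> v k = 0) \<Longrightarrow> (\<Sum>k\<in>I. c k * v k) \<ge> 0"
    "\<And>x. (\<Sum>k\<in>I. c k * g x k) \<le> F x - F u"
    by blast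
  have "psd_on {1..l i} (\<lambda>a b. c (i, a, b))" if i: "i \<in> {1..m}" for i
    unfolding psd_on_def
  proof (intro conjI ballI allI)
    fix a b assume ab: "a \<in> {1..l i}" "b \<in> {1..l i}"
    \<comment> \<open>A skew-symmetric matrix has the zero quadratic form, so it lies in the cone with both signs.\<close>
    have le: "c (i, b', a') \<le> c (i, a', b')" if ab': "a' \<in> {1..l i}" "b' \<in> {1..l i}" for a' b'
    proof -
      define v :: "nat \<times> nat \<times> nat \<Rightarrow> real"
        where "v k = (if k = (i, a', b') then 1 else 0) - (if k = (i, b', a') then 1 else 0)" for k
      have skew: "v (i', p, q) = - v (i', q, p)" for i' p q
        by (cases "i' = i"; cases "p = a'"; cases "q = b'"; cases "p = b'"; cases "q = a'")
           (simp_all add: v_def)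
      have "qf v i' \<xi> = - qf v i' \<xi>" for i' \<xi>
      proof -
        have "qf v i' \<xi> = (\<Sum>p\<in>{1..l i'}. \<Sum>q\<in>{1..l i'}. - (\<xi> q * v (i', q, p) * \<xi> p))"
          unfolding qf_def
        proof (intro sum.cong refl)
          fix p q
          show "\<xi> p * v (i', p, q) * \<xi> q = - (\<xi> q * v (i', q, p) * \<xi> p)"
            using skew[of i' p q] by simp
        qed
        also have "\<dots> = - qf v i' \<xi>"
          unfolding qf_def by (subst sum.swap) (simp add: sum_negf)
        finally show ?thesis .
      qed
      then have "qf v i' \<xi> = 0" for i' \<xi>
        by (simp only: eq_neg_iff_add_eq_0) simp
      then have "v \<in> C" by (simp add: C_def)
      have in_I: "(i, a', b') \<in> I" "(i, b', a') \<in> I"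
        using ab' i by (simp_all add: mem_I)
      have "v k = 0" if "k \<notin> I" for k
      proof -
        have "k \<noteq> (i, a', b')" "k \<noteq> (i, b', a')" using that in_I by blast+
        then show ?thesis by (simp add: v_def)
      qed
      with \<open>v \<in> C\<close> have "0 \<le> (\<Sum>k\<in>I. c k * v k)" by (rule c(1))
      also have "\<dots> = (\<Sum>k\<in>I. if k = (i, a', b') then c k else 0) - (\<Sum>k\<in>I. if k = (i, b', a') then c k else 0)"
      proof -
        have "c k * v k = (if k = (i, a', b') then c k else 0) - (if k = (i, b', a') then c k else 0)" for k
          unfolding v_def by (simp only: right_diff_distrib if_distrib[of "\<lambda>t. c k * t"] mult_1_right mult_zero_right)
        then show ?thesis by (simp only: sum_subtractf)
      qed
      also have "\<dots> = c (i, a', b') - c (i, b', a')"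
        unfolding sum.delta[OF \<open>finite I\<close>] using in_I by simp
      finally show ?thesis by simp
    qed
    show "c (i, a, b) = c (i, b, a)"
      using le[OF ab] le[OF ab(2,1)] by simp
  next
    fix \<xi> :: "nat \<Rightarrow> real"
    define v where "v = (\<lambda>(i', a, b). if i' = i \<and> (i', a, b) \<in> I then \<xi> a * \<xi> b else 0)"
    have "qf v i' \<zeta> \<ge> 0" if i': "i' \<in> {1..m}" for i' \<zeta>
    proof (cases "i' = i")
      case True
      have "qf v i' \<zeta> = (\<Sum>a\<in>{1..l i}. \<zeta> a * \<xi> a)\<^sup>2"
        unfolding qf_def power2_eq_square sum_product True using i
        by (intro sum.cong refl) (simp add: v_def mem_I)
      then show ?thesis by simp
    qed (simp add: qf_def v_def)
    then have "v \<in> C" by (simp add: C_def)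
    moreover have "v k = 0" if "k \<notin> I" for k
      using that by (cases k) (auto simp: v_def)
    ultimately have "0 \<le> (\<Sum>k\<in>I. c k * v k)" by (rule c(1))
    also have "\<dots> = (\<Sum>i'\<in>{1..m}. if i' = i then \<Sum>a\<in>{1..l i}. \<Sum>b\<in>{1..l i}. \<xi> a * c (i, a, b) * \<xi> b else 0)"
      unfolding sum_I using i
      by (intro sum.cong refl) (auto simp: v_def mem_I intro!: sum.cong)
    also have "\<dots> = (\<Sum>a\<in>{1..l i}. \<Sum>b\<in>{1..l i}. \<xi> a * c (i, a, b) * \<xi> b)"
      using i by simp
    finally show "0 \<le> (\<Sum>a\<in>{1..l i}. \<Sum>b\<in>{1..l i}. \<xi> a * c (i, a, b) * \<xi> b)" .
  qed
  moreover have "(\<Sum>i\<in>{1..m}. \<Sum>a\<in>{1..l i}. \<Sum>b\<in>{1..l i}. c (i, a, b) * poly_eval (G i a b) x) \<le> F x - F u" for x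
  proof -
    have "(\<Sum>i\<in>{1..m}. \<Sum>a\<in>{1..l i}. \<Sum>b\<in>{1..l i}. c (i, a, b) * poly_eval (G i a b) x) = (\<Sum>k\<in>I. c k * g x k)"
      unfolding sum_I by (intro sum.cong refl) (simp add: g_def mem_I)
    then show ?thesis using c(2) by simp
  qed
  ultimately show ?thesis
    by (intro exI[of _ "\<lambda>i a b. c (i, a, b)"]) blast
qed

lemma vector_multipliers:
  assumes "slater m l G"
  shows "\<exists>(r :: nat \<Rightarrow> nat) w. \<forall>x. (\<Sum>i\<in>{1..m}. \<Sum>c\<in>{1..r i}. poly_eval (form i (w i c)) x) \<le> F x - F u"
proof -
  obtain \<Lambda> where psd: "\<And>i. i \<in> {1..m} \<Longrightarrow> psd_on {1..l i} (\<Lambda> i)"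
    and le: "\<And>x. (\<Sum>i\<in>{1..m}. \<Sum>a\<in>{1..l i}. \<Sum>b\<in>{1..l i}. \<Lambda> i a b * poly_eval (G i a b) x) \<le> F x - F u"
    using matrix_multipliers[OF assms] by blast
  have "\<exists>(r::nat) w. \<forall>a\<in>{1..l i}. \<forall>b\<in>{1..l i}. \<Lambda> i a b = (\<Sum>c\<in>{1..r}. w c a * w c b)"
    if "i \<in> {1..m}" for i
    using psd[OF that] by (intro psd_factorization) auto
  then obtain r :: "nat \<Rightarrow> nat" and w where w: "\<And>i a b. i \<in> {1..m} \<Longrightarrow> a \<in> {1..l i} \<Longrightarrow> b \<in> {1..l i} \<Longrightarrow>
      \<Lambda> i a b = (\<Sum>c\<in>{1..r i}. w i c a * w i c b)"
    by metis
  have "(\<Sum>a\<in>{1..l i}. \<Sum>b\<in>{1..l i}. \<Lambda> i a b * poly_eval (G i a b) x) =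
      (\<Sum>c\<in>{1..r i}. poly_eval (form i (w i c)) x)" if i: "i \<in> {1..m}" for i x
  proof -
    have "(\<Sum>a\<in>{1..l i}. \<Sum>b\<in>{1..l i}. \<Lambda> i a b * poly_eval (G i a b) x) =
        (\<Sum>a\<in>{1..l i}. \<Sum>b\<in>{1..l i}. \<Sum>c\<in>{1..r i}. w i c a * poly_eval (G i a b) x * w i c b)"
      by (intro sum.cong refl) (simp add: w[OF i] sum_distrib_left mult_ac)
    also have "\<dots> = (\<Sum>c\<in>{1..r i}. poly_eval (form i (w i c)) x)"
      unfolding poly_eval_quad_form by (rule sum_swap_third)
    finally show ?thesis .
  qed
  then show ?thesis using le by (intro exI[of _ r] exI[of _ w]) simp
qed

text \<open>
  The Lagrangian splits along the blocks \<open>\<Delta> i\<close>, and it is minimized by \<open>u\<close> over the whole space. The tangents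
  at \<open>u\<close> of its SOS-convex parts thus add up to a constant, the minimal value, and what remains of each
  part is a sum of squares in the variables of its block. Adding back the multiplier terms, which are
  \<open>P\<^sup>T G P\<close> with constant vectors \<open>P\<close>, gives the certificate.
\<close>

lemma objective_minus_min_in_qmod_spa:
  assumes k: "1 \<le> k" "min_order m l f G \<le> k" and "slater m l G"
  shows "objective m f - const_poly (F u) \<in> qmod_spa m \<Delta> l G k"
proof -
  obtain r :: "nat \<Rightarrow> nat" and w where
    mult: "\<And>x. (\<Sum>i\<in>{1..m}. \<Sum>c\<in>{1..r i}. poly_eval (form i (w i c)) x) \<le> F x - F u"
    using vector_multipliers[OF assms(3)] by blast
  define q where "q i c = form i (w i c)" for i c
  define lagr where "lagr = (\<Sum>i\<in>{1..m}. f i + (\<Sum>c\<in>{1..r i}. - q i c))"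
  have lagr_eval: "poly_eval lagr x = F x - (\<Sum>i\<in>{1..m}. \<Sum>c\<in>{1..r i}. poly_eval (q i c) x)" for x
    by (simp add: lagr_def objective_def sum.distrib sum_negf sum_subtractf)
  have "(\<Sum>i\<in>{1..m}. \<Sum>c\<in>{1..r i}. poly_eval (q i c) u) \<ge> 0"
    using u_feasible unfolding feasible_iff q_def by (intro sum_nonneg) auto
  then have slack: "(\<Sum>i\<in>{1..m}. \<Sum>c\<in>{1..r i}. poly_eval (q i c) u) = 0"
    using mult[of u] unfolding q_def by simp
  then have "poly_eval lagr u \<le> poly_eval lagr x" for x
    using mult[of x] by (simp add: lagr_eval q_def)
  then have flat: "poly_eval (tangent lagr u) x = F u" for x
    using tangent_at_minimum[of lagr u x] slack by (simp add: lagr_eval)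
  define \<sigma> where "\<sigma> i = (f i - tangent (f i) u) + (\<Sum>c\<in>{1..r i}. - q i c - tangent (- q i c) u)" for i
  have "poly_eval (objective m f - const_poly (F u)) x =
      poly_eval (\<Sum>i\<in>{1..m}. \<sigma> i + (\<Sum>c\<in>{1..r i}. q i c)) x" for x
  proof -
    have "poly_eval (tangent lagr u) x = (\<Sum>i\<in>{1..m}. poly_eval (tangent (f i) u) x +
        (\<Sum>c\<in>{1..r i}. poly_eval (tangent (- q i c) u) x))"
      by (simp add: lagr_def poly_eval_tangent_sum poly_eval_tangent_add)
    then show ?thesis
      using flat[of x]
      by (simp add: \<sigma>_def objective_def sum.distrib sum_subtractf sum_negf)
  qed
  then have "objective m f - const_poly (F u) = (\<Sum>i\<in>{1..m}. \<sigma> i + (\<Sum>c\<in>{1..r i}. q i c))"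
    by (rule poly_eval_eq_imp_eq)
  moreover have "\<sigma> i + (\<Sum>c\<in>{1..r i}. q i c) \<in> qmod (\<Delta> i) (l i) (G i) k" if i: "i \<in> {1..m}" for i
  proof -
    have "is_sos (\<Delta> i) (\<sigma> i)"
      unfolding \<sigma>_def q_def using i
      by (intro is_sos_add is_sos_sum sos_hessian_remainder f_vars f_hessian neg_form_vars neg_form_hessian)
    moreover have "poly_deg (\<sigma> i) \<le> 2 * k"
    proof -
      have t: "poly_deg (tangent p u) \<le> 2 * k" for p
        using poly_deg_tangent[of p u] k(1) by linarith
      show ?thesis
        unfolding \<sigma>_def q_def using t f_deg[OF k(2) i] form_deg[OF k(2) i]
        by (intro poly_deg_add poly_deg_sum poly_deg_diff) simp_all
    qed
    ultimately have "\<sigma> i \<in> sos_deg (\<Delta> i) (2 * k)"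
      by (auto simp: sos_deg_def is_sos_def)
    moreover have "vec_deg (l i) (\<lambda>a. const_poly (v a) :: 'n mpoly) = 0" for v
      using size_pos[OF i] by (simp add: vec_deg_def image_constant_conv)
    then have "\<forall>c\<in>{1..r i}. (\<forall>a\<in>{1..l i}. const_poly (w i c a) \<in> polys_in (\<Delta> i)) \<and>
        2 * vec_deg (l i) (\<lambda>a. const_poly (w i c a) :: 'n mpoly) + mat_deg (l i) (G i) \<le> 2 * k"
      using G_deg[OF k(2) i] by (simp add: polys_in_const)
    ultimately show ?thesis
      unfolding qmod_def q_def quad_form_def
      by (intro CollectI exI[of _ "\<sigma> i"] exI[of _ "r i"] exI[of _ "\<lambda>c a. const_poly (w i c a)"]) simp
  qed
  ultimately show ?thesis
    unfolding qmod_spa_def by blast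
qed

lemma qmod_eval_nonneg:
  assumes i: "i \<in> {1..m}" and q: "q \<in> qmod (\<Delta> i) (l i) (G i) k"
  shows "poly_eval q u \<ge> 0"
proof -
  obtain \<sigma> s P where q_eq: "q = \<sigma> + (\<Sum>j\<in>{1..s::nat}. \<Sum>a\<in>{1..l i}. \<Sum>b\<in>{1..l i}. P j a * G i a b * P j b)"
    and \<sigma>: "\<sigma> \<in> sos_deg (\<Delta> i) (2 * k)"
    using q unfolding qmod_def by blast
  have "is_sos (\<Delta> i) \<sigma>"
    using \<sigma> unfolding sos_deg_def is_sos_def by blast
  moreover have "(\<Sum>a\<in>{1..l i}. \<Sum>b\<in>{1..l i}. poly_eval (P j a) u * poly_eval (G i a b) u * poly_eval (P j b) u) \<ge> 0" for j
    using u_feasible[unfolded feasible_iff poly_eval_quad_form, rule_format, OF i, of "\<lambda>a. poly_eval (P j a) u"] .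
  ultimately show ?thesis
    by (simp add: q_eq is_sos_eval_nonneg sum_nonneg)
qed

lemma spa_value_eq:
  assumes k: "1 \<le> k" "min_order m l f G \<le> k" and "slater m l G"
  shows "spa_value m \<Delta> l f G k = ereal (F u)"
proof (rule antisym)
  show "spa_value m \<Delta> l f G k \<le> ereal (F u)"
    unfolding spa_value_def
  proof (rule SUP_least)
    fix \<gamma> assume "\<gamma> \<in> {\<gamma>. objective m f - const_poly \<gamma> \<in> qmod_spa m \<Delta> l G k}"
    then obtain q where q: "objective m f - const_poly \<gamma> = (\<Sum>i\<in>{1..m}. q i)"
      "\<And>i. i \<in> {1..m} \<Longrightarrow> q i \<in> qmod (\<Delta> i) (l i) (G i) k"
      unfolding qmod_spa_def by blast
    have "F u - \<gamma> = (\<Sum>i\<in>{1..m}. poly_eval (q i) u)"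
      using arg_cong[OF q(1), of "\<lambda>p. poly_eval p u"] by simp
    also have "\<dots> \<ge> 0" using q(2) by (intro sum_nonneg qmod_eval_nonneg)
    finally show "ereal \<gamma> \<le> ereal (F u)" by simp
  qed
  show "ereal (F u) \<le> spa_value m \<Delta> l f G k"
    unfolding spa_value_def using objective_minus_min_in_qmod_spa[OF assms]
    by (intro SUP_upper) simp
qed

end

theorem theorem5p2:
  fixes m :: nat
    and \<Delta> :: "nat \<Rightarrow> 'n::finite set"
    and l :: "nat \<Rightarrow> nat"
    and f :: "nat \<Rightarrow> 'n mpoly"
    and G :: "nat \<Rightarrow> nat \<Rightarrow> nat \<Rightarrow> 'n mpoly"
    and u :: "real ^ 'n"
  assumes cover: "(\<Union>i\<in>{1..m}. \<Delta> i) = UNIV"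
    and size_pos: "\<And>i. i \<in> {1..m} \<Longrightarrow> l i \<ge> 1"
    and f_vars: "\<And>i. i \<in> {1..m} \<Longrightarrow> f i \<in> polys_in (\<Delta> i)"
    and G_vars: "\<And>i a b. i \<in> {1..m} \<Longrightarrow> a \<in> {1..l i} \<Longrightarrow> b \<in> {1..l i} \<Longrightarrow>
                   G i a b \<in> polys_in (\<Delta> i)"
    and G_sym: "\<And>i a b. i \<in> {1..m} \<Longrightarrow> a \<in> {1..l i} \<Longrightarrow> b \<in> {1..l i} \<Longrightarrow>
                   G i a b = G i b a"
    and minimizer: "is_minimizer m l f G u"
    and f_convex: "\<And>i. i \<in> {1..m} \<Longrightarrow> sos_convex (\<Delta> i) (f i)"
    and G_concave: "\<And>i. i \<in> {1..m} \<Longrightarrow> sos_concave_mat (\<Delta> i) (l i) (G i)"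
  shows "(\<forall>k\<ge>1. k \<ge> min_order m l f G \<longrightarrow> smo_value m \<Delta> l f G k = opt_value m l f G) \<and>
         (slater m l G \<longrightarrow>
            (\<forall>k\<ge>1. k \<ge> min_order m l f G \<longrightarrow>
               spa_value m \<Delta> l f G k = opt_value m l f G \<and>
               objective m f - const_poly (real_of_ereal (opt_value m l f G))
                 \<in> qmod_spa m \<Delta> l G k)) \<and>
         (\<forall>k\<ge>1. k \<ge> min_order m l f G \<longrightarrow>
            (\<forall>y. is_moment_minimizer m \<Delta> l f G k y \<longrightarrow>
               is_minimizer m l f G (\<chi> j. y (unit_mono j))))"
proof -
  interpret sparse_sos_convex_program m \<Delta> l f G u
    using assms by unfold_locales
  show ?thesis
    using smo_value_eq spa_value_eq objective_minus_min_in_qmod_spa moment_minimizer_imp_minimizer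
    by (simp add: opt_value_eq)
qed

end
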